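(* Let $\Phi:\Delta\to\mathbb{R}^{n\times n}$, $\Delta=\{(t,\tau)\in\mathbb{R}\times\mathbb{R}:t\ge\tau\}$, be measurable and locally essentially bounded. Let measurable functions $a,\tilde a:\mathbb{R}\times\mathbb{R}^n\to\mathbb{R}^n$, $b,\tilde b:\mathbb{R}\times\mathbb{R}^n\to\mathbb{R}^{n\times m}$ be locally essentially bounded and continuous in $x$, and let a measurable function $u:\mathbb{R}\times\mathbb{R}^n\to\mathbb{R}^m$ be locally essentially bounded. Let $\mathcal{S}=\{x\in\mathbb{R}^n:s(x)=0\}$, $s\in C^1(\mathbb{R}^n;\mathbb{R}^m)$, be the discontinuity set of $u$, where $u$ is piece-wise Lipschitz continuous. Let the matrix $G(t,x)=\frac{\partial s(x)}{\partial x}b(t,x)$ be non-singular for almost all $t\in\mathbb{R}$ and for all $x\in\mathbb{R}^n$, and let $(t,x)\mapsto G^{-1}(t,x)$ be locally essentially bounded on $\mathbb{R}\times\mathbb{R}^n$. Consider the IVP $$\dot x(t)=a(t,x(t))+b(t,x(t))u(t,x(t))+\int_{t^0}^t\Phi(t,\tau)\left(\tilde a(\tau,x(\tau))+\tilde b(\tau,x(\tau))u(\tau,x(\tau))\right)d\tau,\qquad x(t^0)=x^0.\qquad(\ast)$$ i) If $x:[t^0,t^1]\to\mathbb{R}^n$ is an Utkin solution of $(\ast)$ on $\mathcal{I}=[t^0,t^1]$ such that $x(t)\notin\mathcal{S}$ for $t\in[t^0,t^* )$ and $x(t)\in\mathcal{S}$ for $t\in[t^*,t^1]$, then the equivalent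 control $u_{\rm eq}:[t^0,t^1]\to\mathbb{R}^m$ is given by $$u_{\rm eq}(t)=\begin{cases}u(t,x(t)),& t\in[t^0,t^* ),\\ \sum_{i=0}^\infty(\mathcal{K}^ig)(t),& t\in[t^*,t^1],\end{cases}$$ where $\mathcal{K}:L^\infty((t^*,t^1);\mathbb{R}^m)\to L^\infty((t^*,t^1);\mathbb{R}^m)$ is the linear bounded operator $$(\mathcal{K}\tilde u)(t)=\int_{t^*}^tG^{-1}(t,x(t))\Phi(t,\tau)\tilde b(\tau,x(\tau))\tilde u(\tau)\,d\tau,$$ and $g\in L^\infty((t^*,t^1);\mathbb{R}^m)$ is as follows: $$g(t)=-G^{-1}(t,x(t))\left.\tfrac{\partial s(y)}{\partial y}\right|_{y=x(t)}\left(a(t,x(t))+\tilde g(t)\right),$$ $$\tilde g(t)=\int_{t^0}^{t^*}\Phi(t,\tau)\left(\tilde a(\tau,x(\tau))+\tilde b(\tau,x(\tau))u(\tau,x(\tau))\right)d\tau.$$ ii) If $a,b,\tilde a,\tilde b,\frac{\partial s}{\partial x}$ are locally Lipschitz continuous and $G(t,y_1)=G(t,y_2)$, $\tilde b(t,y_1)=\tilde b(t,y_2)$ for all $y_1,y_2\in\mathcal{S}$, then any Utkin solution of $(\ast)$ belonging to $\mathcal{S}$ is unique.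
   Context: $\mathcal{B}(r)\subset\mathbb{R}^n$ is the open ball of radius $r>0$ centered at $0$; $\|\cdot\|$ is the Euclidean norm. A function is locally essentially bounded on a set if its norm has finite essential supremum over every compact subset of that set. Filippov regularization of a function $h$ of $(t,x)\in\mathbb{R}\times\mathbb{R}^n$: $K[h](t,x)=\bigcap_{\delta>0}\bigcap_{\mu(M)=0}\overline{\mathrm{co}}\,h(t,x+\mathcal{B}(\delta)\setminus M)$, where $\overline{\mathrm{co}}$ is the convex closure and the intersections are over all $\delta>0$ and all $M\subset\mathbb{R}^n$ of Lebesgue measure zero. Utkin solution of the first kind (resp. second kind) of $(\ast)$ on an interval $\mathcal{I}$ starting at $t^0$: an absolutely continuous $x:\mathcal{I}\to\mathbb{R}^n$ with $x(t^0)=x^0$ for which there is a measurable $u_{\rm eq}:\mathcal{I}\to\mathbb{R}^m$ (called the equivalent control) such that, almost everywhere on $\mathcal{I}$, $u_{\rm eq}(t)\in U(t,x(t))$ and $\dot x(t)=a(t,x(t))+b(t,x(t))u_{\rm eq}(t)+\int_{t^0}^t\Phi(t,\tau)(\tilde a(\tau,x(\tau))+\tilde b(\tau,x(\tau))u_{\rm eq}(\tau))\,d\tau$, where $U=K[u]$ (resp. $U=(K[u_1],\dots,K[u_m])^\top$, the product set, for $u=(u_1,\dots,u_m)^\top$). "Utkin solution" without further specification refers to either kind. A measurable function $h$ of $(t,x)\in\mathbb{R}\times\mathbb{R}^n$ is locally Lipschitz (continuous) if for every compact $\mathcal{X}\subset\mathbb{R}^n$ there is $\ell\in L^\infty_{\rm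 loc}(\mathbb{R};\mathbb{R})$ with $\|h(t,x)-h(t,y)\|\le\ell(t)\|x-y\|$ for all $t\in\mathbb{R}$, $x,y\in\mathcal{X}$. A measurable $h$ on $\mathbb{R}\times\mathbb{R}^n$ is piece-wise Lipschitz continuous (in $x$) if: there are finitely many open connected sets $G^1,\dots,G^N\subset\mathbb{R}^n$ with non-empty interiors and continuous boundaries $\partial G^j$, such that $\bigcup_{j=1}^N\overline{G^j}=\mathbb{R}^n$, $G^i\cap G^j=\emptyset$ for $i\ne j$, and the boundary set $\bigcup_{j=1}^N\partial G^j$ (called the discontinuity set of $h$) has measure zero; and for each $j$ there is a locally Lipschitz continuous function $h^j$ on $\mathbb{R}\times\mathbb{R}^n$ such that $h^j(t,x)=h(t,x)$ for all $x\in G^j$ and almost all $t\in\mathbb{R}$.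
   Formalization: The printed formulas in i) fail; corrected: the kernel of K is −G^{-1}(t,x(t)) (∂s/∂x)(x(t)) Φ(t,τ) b̃(τ,x(τ)) (sign and factor ∂s/∂x added), and g̃(t) gains the term ∫_{t*}^t Φ(t,τ) ã(τ,x(τ)) dτ. *)

theory Defs
  imports "HOL-Analysis.Analysis" "HOL-Probability.Essential_Supremum"
begin

section \<open>Essentially bounded functions\<close>

text \<open>Elements of \<open>L\<^sup>\<infinity>\<close> are represented by functions; equality in \<open>L\<^sup>\<infinity>\<close> is equality almost everywhere.
  Measurability always refers to Lebesgue measurable sets.\<close>

definition Linf_norm :: "'a::euclidean_space set \<Rightarrow> ('a \<Rightarrow> 'b::real_normed_vector) \<Rightarrow> ennreal" where
  "Linf_norm A f = esssup (lebesgue_on A) (\<lambda>x. ennreal (norm (f x)))"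

definition Linf :: "'a::euclidean_space set \<Rightarrow> ('a \<Rightarrow> 'b::real_normed_vector) set" where
  "Linf A = {f \<in> borel_measurable (lebesgue_on A). Linf_norm A f < \<infinity>}"

definition locally_ess_bounded_on ::
  "'a::euclidean_space set \<Rightarrow> ('a \<Rightarrow> 'b::real_normed_vector) \<Rightarrow> bool" where
  "locally_ess_bounded_on A f \<longleftrightarrow> (\<forall>K. compact K \<and> K \<subseteq> A \<longrightarrow> Linf_norm K f < \<infinity>)"

text \<open>The bound also makes the operator respect equality almost everywhere.\<close>

definition bounded_linear_Linf ::
  "'a::euclidean_space set \<Rightarrow> (('a \<Rightarrow> 'b::real_normed_vector) \<Rightarrow> 'a \<Rightarrow> 'b) \<Rightarrow> bool" where
  "bounded_linear_Linf A K \<longleftrightarrow>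
     (\<forall>f \<in> Linf A. K f \<in> Linf A) \<and>
     (\<forall>f \<in> Linf A. \<forall>g \<in> Linf A.
        AE t in lebesgue_on A. K (\<lambda>\<tau>. f \<tau> + g \<tau>) t = K f t + K g t) \<and>
     (\<forall>f \<in> Linf A. \<forall>c. AE t in lebesgue_on A. K (\<lambda>\<tau>. c *\<^sub>R f \<tau>) t = c *\<^sub>R K f t) \<and>
     (\<exists>B::real. \<forall>f \<in> Linf A. Linf_norm A (K f) \<le> ennreal B * Linf_norm A f)"


section \<open>Regularity of functions of \<open>(t, x)\<close>\<close>

definition measurable_tx :: "(real \<Rightarrow> 'a::euclidean_space \<Rightarrow> 'b::real_normed_vector) \<Rightarrow> bool" where
  "measurable_tx h \<longleftrightarrow> (\<lambda>(t, x). h t x) \<in> borel_measurable lebesgue"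

definition locally_ess_bounded_tx ::
  "(real \<Rightarrow> 'a::euclidean_space \<Rightarrow> 'b::real_normed_vector) \<Rightarrow> bool" where
  "locally_ess_bounded_tx h \<longleftrightarrow> locally_ess_bounded_on UNIV (\<lambda>(t, x). h t x)"

definition locally_Lipschitz_tx ::
  "(real \<Rightarrow> 'a::euclidean_space \<Rightarrow> 'b::real_normed_vector) \<Rightarrow> bool" where
  "locally_Lipschitz_tx h \<longleftrightarrow> measurable_tx h \<and>
     (\<forall>X. compact X \<longrightarrow>
        (\<exists>l :: real \<Rightarrow> real. l \<in> borel_measurable lebesgue \<and> locally_ess_bounded_on UNIV l \<and>
           (\<forall>t. \<forall>x \<in> X. \<forall>y \<in> X. norm (h t x - h t y) \<le> l t * norm (x - y))))"

text \<open>The boundary of \<open>G\<close> is locally the graph of a continuous function over a linear subspace \<open>V\<close>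
  with values in the orthogonal complement of \<open>V\<close>. Hypersurfaces are the case \<open>dim V = n - 1\<close>; other
  dimensions are allowed because the zero set of a map into \<open>\<real>\<^sup>m\<close> of rank \<open>m\<close> has codimension \<open>m\<close>.\<close>

definition continuous_boundary :: "'a::euclidean_space set \<Rightarrow> bool" where
  "continuous_boundary G \<longleftrightarrow>
     (\<forall>x \<in> frontier G. \<exists>r > 0. \<exists>V \<gamma>.
        subspace V \<and> continuous_on V \<gamma> \<and> \<gamma> ` V \<subseteq> V\<^sup>\<bottom> \<and>
        frontier G \<inter> ball x r = {v + \<gamma> v | v. v \<in> V} \<inter> ball x r)"

text \<open>Piece-wise Lipschitz continuity in \<open>x\<close> with discontinuity set \<open>D\<close>. The exceptional null set of
  times is uniform in \<open>x\<close>.\<close>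

definition piecewise_Lipschitz_tx ::
  "(real \<Rightarrow> 'a::euclidean_space \<Rightarrow> 'b::real_normed_vector) \<Rightarrow> 'a set \<Rightarrow> bool" where
  "piecewise_Lipschitz_tx h D \<longleftrightarrow> measurable_tx h \<and>
     (\<exists>(N::nat) (G :: nat \<Rightarrow> 'a set).
        (\<forall>j \<in> {1..N}. open (G j) \<and> connected (G j) \<and> interior (G j) \<noteq> {} \<and>
                      continuous_boundary (G j)) \<and>
        (\<Union>j \<in> {1..N}. closure (G j)) = UNIV \<and>
        (\<forall>i \<in> {1..N}. \<forall>j \<in> {1..N}. i \<noteq> j \<longrightarrow> G i \<inter> G j = {}) \<and>
        D = (\<Union>j \<in> {1..N}. frontier (G j)) \<and> D \<in> null_sets lebesgue \<and>
        (\<forall>j \<in> {1..N}. \<exists>hj. locally_Lipschitz_tx hj \<and>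
           (AE t in lebesgue. \<forall>x \<in> G j. hj t x = h t x)))"

definition C1_map :: "(real^'n \<Rightarrow> real^'m) \<Rightarrow> bool" where
  "C1_map s \<longleftrightarrow> s differentiable_on UNIV \<and> continuous_on UNIV (\<lambda>x. jacobian s (at x))"


section \<open>Utkin solutions\<close>

definition absolutely_continuous_fun_on :: "real set \<Rightarrow> (real \<Rightarrow> 'a::real_normed_vector) \<Rightarrow> bool" where
  "absolutely_continuous_fun_on S f \<longleftrightarrow>
     (\<forall>\<epsilon> > 0. \<exists>\<delta> > 0. \<forall>P :: (real \<times> real) set.
        finite P \<and> (\<forall>(c, d) \<in> P. c \<le> d \<and> {c..d} \<subseteq> S) \<and>
        pairwise (\<lambda>p q. {fst p<..<snd p} \<inter> {fst q<..<snd q} = {}) P \<and>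
        (\<Sum>(c, d) \<in> P. d - c) < \<delta>
        \<longrightarrow> (\<Sum>(c, d) \<in> P. norm (f d - f c)) < \<epsilon>)"

definition interval_from :: "real \<Rightarrow> real set \<Rightarrow> bool" where
  "interval_from t0 I \<longleftrightarrow> is_interval I \<and> t0 \<in> I \<and> (\<forall>t \<in> I. t0 \<le> t)"

definition Filippov ::
  "(real \<Rightarrow> 'a::euclidean_space \<Rightarrow> 'b::real_normed_vector) \<Rightarrow> real \<Rightarrow> 'a \<Rightarrow> 'b set" where
  "Filippov h t x =
     (\<Inter>\<delta> \<in> {0<..}. \<Inter>M \<in> null_sets lebesgue. closure (convex hull (h t ` (ball x \<delta> - M))))"

definition Filippov_componentwise ::
  "(real \<Rightarrow> 'a::euclidean_space \<Rightarrow> real^'m) \<Rightarrow> real \<Rightarrow> 'a \<Rightarrow> (real^'m) set" where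
  "Filippov_componentwise u t x = {v. \<forall>i. v $ i \<in> Filippov (\<lambda>t x. u t x $ i) t x}"

text \<open>\<open>x\<close> solves the initial value problem on \<open>I\<close> with equivalent control \<open>ueq\<close> taking values in \<open>U\<close>.
  On an interval that is not compact, absolute continuity is meant on its compact subintervals.
  Integrability excludes the default value of the Bochner integral.\<close>

definition solution_with_control ::
  "(real \<Rightarrow> real^'n \<Rightarrow> real^'n) \<Rightarrow> (real \<Rightarrow> real^'n \<Rightarrow> real^'m^'n) \<Rightarrow>
   (real \<Rightarrow> real \<Rightarrow> real^'n^'n) \<Rightarrow>
   (real \<Rightarrow> real^'n \<Rightarrow> real^'n) \<Rightarrow> (real \<Rightarrow> real^'n \<Rightarrow> real^'m^'n) \<Rightarrow>
   (real \<Rightarrow> real^'n \<Rightarrow> (real^'m) set) \<Rightarrow> real \<Rightarrow> real^'n \<Rightarrow> real set \<Rightarrow>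
   (real \<Rightarrow> real^'n) \<Rightarrow> (real \<Rightarrow> real^'m) \<Rightarrow> bool" where
  "solution_with_control a b \<Phi> a' b' U t0 x0 I x ueq \<longleftrightarrow>
     interval_from t0 I \<and>
     (\<forall>c d. {c..d} \<subseteq> I \<longrightarrow> absolutely_continuous_fun_on {c..d} x) \<and>
     x t0 = x0 \<and>
     ueq \<in> borel_measurable (lebesgue_on I) \<and>
     (AE t in lebesgue_on I.
        ueq t \<in> U t (x t) \<and>
        integrable (lebesgue_on {t0..t}) (\<lambda>\<tau>. \<Phi> t \<tau> *v (a' \<tau> (x \<tau>) + b' \<tau> (x \<tau>) *v ueq \<tau>)) \<and>
        (x has_vector_derivative
           (a t (x t) + b t (x t) *v ueq t +
            (LINT \<tau>|lebesgue_on {t0..t}. \<Phi> t \<tau> *v (a' \<tau> (x \<tau>) + b' \<tau> (x \<tau>) *v ueq \<tau>))))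
          (at t within I))"

definition Utkin_first_kind where
  "Utkin_first_kind a b \<Phi> a' b' u t0 x0 I x ueq \<longleftrightarrow>
     solution_with_control a b \<Phi> a' b' (Filippov u) t0 x0 I x ueq"

definition Utkin_second_kind where
  "Utkin_second_kind a b \<Phi> a' b' u t0 x0 I x ueq \<longleftrightarrow>
     solution_with_control a b \<Phi> a' b' (Filippov_componentwise u) t0 x0 I x ueq"

definition Utkin_solution_with where
  "Utkin_solution_with a b \<Phi> a' b' u t0 x0 I x ueq \<longleftrightarrow>
     Utkin_first_kind a b \<Phi> a' b' u t0 x0 I x ueq \<or>
     Utkin_second_kind a b \<Phi> a' b' u t0 x0 I x ueq"

definition Utkin_solution where
  "Utkin_solution a b \<Phi> a' b' u t0 x0 I x \<longleftrightarrow>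
     (\<exists>ueq. Utkin_solution_with a b \<Phi> a' b' u t0 x0 I x ueq)"


section \<open>The equivalent control on the sliding manifold\<close>

definition G_matrix ::
  "(real^'n \<Rightarrow> real^'m) \<Rightarrow> (real \<Rightarrow> real^'n \<Rightarrow> real^'m^'n) \<Rightarrow> real \<Rightarrow> real^'n \<Rightarrow> real^'m^'m" where
  "G_matrix s b t x = jacobian s (at x) ** b t x"

text \<open>Differentiating \<open>s (x t) = 0\<close> along a solution gives, with \<open>D\<close> the Jacobian of \<open>s\<close> at \<open>x t\<close>,
  \<open>G *v ueq t = - D *v (a + (\<integral>\<^sub>t\<^sub>0\<^sup>t \<Phi> t \<tau> *v (a' + b' *v ueq)))\<close>. The operator below is the part of
  \<open>ueq t\<close> depending on the values of \<open>ueq\<close> after \<open>ts\<close>; all other terms, including those with \<open>a'\<close> after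
  \<open>ts\<close>, are collected in \<open>sliding_g\<close>.\<close>

definition sliding_operator ::
  "(real^'n \<Rightarrow> real^'m) \<Rightarrow> (real \<Rightarrow> real^'n \<Rightarrow> real^'m^'n) \<Rightarrow> (real \<Rightarrow> real \<Rightarrow> real^'n^'n) \<Rightarrow>
   (real \<Rightarrow> real^'n \<Rightarrow> real^'m^'n) \<Rightarrow> (real \<Rightarrow> real^'n) \<Rightarrow> real \<Rightarrow>
   (real \<Rightarrow> real^'m) \<Rightarrow> real \<Rightarrow> real^'m" where
  "sliding_operator s b \<Phi> b' x ts v t =
     - (LINT \<tau>|lebesgue_on {ts..t}.
          (matrix_inv (G_matrix s b t (x t)) ** jacobian s (at (x t)) ** \<Phi> t \<tau> ** b' \<tau> (x \<tau>)) *v v \<tau>)"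

definition sliding_g_tilde ::
  "(real \<Rightarrow> real \<Rightarrow> real^'n^'n) \<Rightarrow> (real \<Rightarrow> real^'n \<Rightarrow> real^'n) \<Rightarrow>
   (real \<Rightarrow> real^'n \<Rightarrow> real^'m^'n) \<Rightarrow> (real \<Rightarrow> real^'n \<Rightarrow> real^'m) \<Rightarrow> (real \<Rightarrow> real^'n) \<Rightarrow>
   real \<Rightarrow> real \<Rightarrow> real \<Rightarrow> real^'n" where
  "sliding_g_tilde \<Phi> a' b' u x t0 ts t =
     (LINT \<tau>|lebesgue_on {t0..ts}. \<Phi> t \<tau> *v (a' \<tau> (x \<tau>) + b' \<tau> (x \<tau>) *v u \<tau> (x \<tau>))) +
     (LINT \<tau>|lebesgue_on {ts..t}. \<Phi> t \<tau> *v a' \<tau> (x \<tau>))"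

definition sliding_g ::
  "(real^'n \<Rightarrow> real^'m) \<Rightarrow> (real \<Rightarrow> real^'n \<Rightarrow> real^'n) \<Rightarrow> (real \<Rightarrow> real^'n \<Rightarrow> real^'m^'n) \<Rightarrow>
   (real \<Rightarrow> real \<Rightarrow> real^'n^'n) \<Rightarrow> (real \<Rightarrow> real^'n \<Rightarrow> real^'n) \<Rightarrow>
   (real \<Rightarrow> real^'n \<Rightarrow> real^'m^'n) \<Rightarrow> (real \<Rightarrow> real^'n \<Rightarrow> real^'m) \<Rightarrow> (real \<Rightarrow> real^'n) \<Rightarrow>
   real \<Rightarrow> real \<Rightarrow> real \<Rightarrow> real^'m" where
  "sliding_g s a b \<Phi> a' b' u x t0 ts t =
     - (matrix_inv (G_matrix s b t (x t)) *v
          (jacobian s (at (x t)) *v (a t (x t) + sliding_g_tilde \<Phi> a' b' u x t0 ts t)))"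

end

theory Submission
  imports Defs
begin

text \<open>As long as the trajectory stays away from the surface \<open>s = 0\<close>, it lies in one of the open pieces on
  which \<open>u\<close> is continuous in \<open>x\<close> at almost every time. The convexified set shrinks to the single value
  \<open>u t (x t)\<close>, and the equivalent control has no choice (\<open>piecewise_Lipschitz_tx_Utkin_set\<close>). On the surface the control is
  determined by the constraint instead. Differentiating \<open>s (x t) = 0\<close> and solving for the control
  through the invertible matrix \<open>G\<close> expresses the control at time \<open>t\<close> by its state and its past
  (\<open>equivalent_control\<close>). That past contains the control itself, but only under an integral from the
  time at which sliding begins to \<open>t\<close>, so the control \<open>v\<close> solves a Volterra equation of the second kind,
  \<open>v = g + K v\<close> (\<open>sliding_fixed_point\<close>).

  The kernel of \<open>K\<close> is essentially bounded, say by \<open>M\<close>, so iterating \<open>K\<close> integrates over simplices and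
  \<open>K\<^sup>k v\<close> is at most \<open>C (M (t - c))\<^sup>k / k!\<close> when \<open>v\<close> is at most \<open>C\<close>. The remainder
  of the Neumann series after \<open>k\<close> terms is exactly \<open>K\<^sup>k v\<close>; hence the series converges to \<open>v\<close> however
  large \<open>M\<close> is (\<open>Neumann_series\<close>). The control is essentially bounded because a Filippov set only averages
  values of the locally essentially bounded \<open>u\<close> (\<open>Utkin_control_Linf\<close>).

  For uniqueness, let \<open>e t\<close> be the sum of the distances of the two controls and of the two velocities at
  time \<open>t\<close>. The formula for the equivalent control and the Lipschitz bounds give \<open>e t \<le> C * E t\<close> with
  \<open>E t\<close> the integral of \<open>e\<close> up to \<open>t\<close>, and the same factorial estimate forces \<open>e = 0\<close> almost everywhere
  (\<open>integral_inequality_imp_AE_zero\<close>). This needs the fact that an absolutely continuous curve is the integral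
  of its derivative (\<open>absolutely_continuous_has_integral\<close>), so that the trajectories are no further
  apart than \<open>E\<close>.

  All data are only Lebesgue measurable, and their bounds hold up to null sets of \<open>(t, x)\<close> or \<open>(t, \<tau>)\<close>. Two tools make
  it possible to work along one trajectory: almost every slice of a null set is null, which turns joint
  statements into statements for almost every time, and continuity in \<open>x\<close> turns bounds for almost
  every \<open>x\<close> into bounds for every \<open>x\<close>.\<close>

section \<open>Lebesgue measure on product spaces\<close>

lemma AE_lebesgue_on_iff:
  "S \<in> sets lebesgue \<Longrightarrow> (AE x in lebesgue_on S. P x) \<longleftrightarrow> (AE x in lebesgue. x \<in> S \<longrightarrow> P x)"
  by (simp add: AE_restrict_space_iff)

lemma atLeastAtMost_sets_lebesgue: "{c..d::real} \<in> sets lebesgue"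
  by simp

text \<open>Lebesgue measure on a product is the completion of the product measure, so the Fubini theorems
  do not apply to Lebesgue measurable functions directly. They apply to a Borel function that agrees
  almost everywhere.\<close>

lemma ex_borel_representative:
  fixes f :: "'a::euclidean_space \<Rightarrow> 'b::euclidean_space"
  assumes "f \<in> borel_measurable lebesgue"
  obtains f' where "f' \<in> borel_measurable borel" "AE x in lebesgue. f x = f' x"
proof -
  have "\<exists>g'\<in>borel_measurable lborel. (AE x in lborel. f x \<bullet> b = g' x)" for b :: 'b
    using assms by (intro completion_ex_borel_measurable_real) simp
  then obtain g where g: "\<And>b. g b \<in> borel_measurable lborel" 
      "\<And>b. AE x in lborel. f x \<bullet> b = g b x"
    by metis
  have "AE x in lborel. \<forall>b\<in>Basis. f x \<bullet> b = g b x"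
    using g(2) by (intro AE_finite_allI) auto
  then have "AE x in lebesgue. f x = (\<Sum>b\<in>Basis. g b x *\<^sub>R b)"
    unfolding AE_completion_iff by eventually_elim (simp add: euclidean_representation_sum' flip: euclidean_representation)
  moreover have "(\<lambda>x. \<Sum>b\<in>Basis. g b x *\<^sub>R b) \<in> borel_measurable borel"
    using g(1) by measurable
  ultimately show ?thesis using that by blast
qed

lemma borel_measurable_lebesgue_on_AE:
  fixes f g :: "'a::euclidean_space \<Rightarrow> 'b::euclidean_space"
  assumes "f \<in> borel_measurable (lebesgue_on S)" "AE x in lebesgue_on S. f x = g x" "S \<in> sets lebesgue"
  shows "g \<in> borel_measurable (lebesgue_on S)"
proof -
  have "(\<lambda>x. if x \<in> S then f x else 0) \<in> borel_measurable lebesgue"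
    using assms(1,3) by (subst borel_measurable_if) auto
  moreover have "AE x in lebesgue. (if x \<in> S then f x else 0) = (if x \<in> S then g x else 0)"
    using assms(2) unfolding AE_lebesgue_on_iff[OF assms(3)] by (rule eventually_mono) simp
  ultimately have "(\<lambda>x. if x \<in> S then g x else 0) \<in> borel_measurable lebesgue"
    by (rule borel_measurable_AE)
  then show ?thesis
    using assms(3) by (subst (asm) borel_measurable_if) auto
qed

lemma AE_lebesgue_prod:
  fixes P :: "'a::euclidean_space \<times> 'b::euclidean_space \<Rightarrow> bool"
  assumes "AE z in lebesgue. P z"
  shows AE_lebesgue_slice: "AE x in lebesgue. AE y in lebesgue. P (x, y)"
    and AE_lebesgue_slice_swap: "AE y in lebesgue. AE x in lebesgue. P (x, y)"
proof -
  have "AE z in lborel \<Otimes>\<^sub>M lborel. P z"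
    using assms unfolding AE_completion_iff lborel_prod .
  then obtain N where N: "N \<in> null_sets (lborel \<Otimes>\<^sub>M lborel)" and sub: "\<And>z. z \<notin> N \<Longrightarrow> P z"
    by (elim AE_E3) (auto simp: space_pair_measure)
  have "AE z in lborel \<Otimes>\<^sub>M lborel. z \<notin> N"
    by (rule AE_not_in[OF N])
  then have 1: "AE x in lborel. AE y in lborel. (x, y) \<notin> N"
    by (rule lborel_pair.AE_pair)
  have "{z \<in> space (lborel \<Otimes>\<^sub>M lborel). (fst z, snd z) \<notin> N} = space (lborel \<Otimes>\<^sub>M lborel) - N"
    by auto
  also have "\<dots> \<in> sets (lborel \<Otimes>\<^sub>M lborel)"
    using null_setsD2[OF N] by blast
  finally have "{z \<in> space (lborel \<Otimes>\<^sub>M lborel). (fst z, snd z) \<notin> N} \<in> sets (lborel \<Otimes>\<^sub>M lborel)" .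
  from lborel_pair.AE_commute[OF this] 1
  have 2: "AE y in lborel. AE x in lborel. (x, y) \<notin> N"
    by simp
  show "AE x in lebesgue. AE y in lebesgue. P (x, y)"
    unfolding AE_completion_iff using 1 sub
    by (auto elim!: eventually_mono)
  show "AE y in lebesgue. AE x in lebesgue. P (x, y)"
    unfolding AE_completion_iff using 2 sub
    by (auto elim!: eventually_mono)
qed

lemma AE_lebesgue_snd:
  assumes "AE x in lebesgue. P x"
  shows "AE z in (lebesgue :: ('a::euclidean_space \<times> 'b::euclidean_space) measure). P (snd z)"
proof -
  obtain N where N: "N \<in> null_sets lborel" and sub: "\<And>x. x \<notin> N \<Longrightarrow> P x"
    using assms unfolding AE_completion_iff by (elim AE_E3) auto
  have "AE x in lborel. x \<notin> N"
    by (rule AE_not_in[OF N])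
  moreover have "{z \<in> space ((lborel :: 'a measure) \<Otimes>\<^sub>M lborel). snd z \<notin> N} \<in> sets ((lborel :: 'a measure) \<Otimes>\<^sub>M lborel)"
    using null_setsD2[OF N] by measurable
  ultimately have "AE z in (lborel :: 'a measure) \<Otimes>\<^sub>M lborel. snd z \<notin> N"
    by (intro lborel_pair.AE_pair_measure) auto
  then show ?thesis
    unfolding AE_completion_iff lborel_prod by (rule eventually_mono) (rule sub)
qed

lemma measurable_lebesgue_snd:
  fixes f :: "'b::euclidean_space \<Rightarrow> 'c::euclidean_space"
  assumes "f \<in> borel_measurable lebesgue"
  shows "(\<lambda>z::'a::euclidean_space \<times> 'b. f (snd z)) \<in> borel_measurable lebesgue"
proof -
  obtain f' where f': "f' \<in> borel_measurable borel" "AE x in lebesgue. f x = f' x"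
    using ex_borel_representative[OF assms] .
  have "(\<lambda>z::'a \<times> 'b. f' (snd z)) \<in> borel_measurable lborel"
    using f'(1) by (simp add: flip: borel_prod)
  moreover have "AE z in (lebesgue :: ('a \<times> 'b) measure). f' (snd z) = f (snd z)"
    using AE_lebesgue_snd[OF f'(2)] by (auto elim!: eventually_mono)
  ultimately show ?thesis
    by (rule borel_measurable_AE[OF measurable_completion])
qed

text \<open>The domain of integration of a Volterra kernel: time \<open>t\<close> first, then an earlier time \<open>\<tau>\<close>.\<close>

definition triangle :: "real \<Rightarrow> real \<Rightarrow> (real \<times> real) set" where
  "triangle c d = {(t, \<tau>). c \<le> \<tau> \<and> \<tau> \<le> t \<and> t \<le> d}"

lemma compact_triangle: "compact (triangle c d)"
proof -
  have "triangle c d = {z. c \<le> snd z} \<inter> {z. snd z \<le> fst z} \<inter> {z. fst z \<le> d}"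
    by (auto simp: triangle_def)
  moreover have "closed ({z. c \<le> snd z} \<inter> {z::real\<times>real. snd z \<le> fst z} \<inter> {z. fst z \<le> d})"
    by (intro closed_Int closed_Collect_le continuous_intros)
  ultimately have "closed (triangle c d)" by simp
  moreover have "triangle c d \<subseteq> {c..d} \<times> {c..d}"
    by (auto simp: triangle_def)
  then have "bounded (triangle c d)"
    by (metis bounded_Times bounded_closed_interval bounded_subset)
  ultimately show ?thesis by (simp add: compact_eq_bounded_closed)
qed

lemma triangle_sets [measurable, simp]: "triangle c d \<in> sets lebesgue"
  using lmeasurable_compact[OF compact_triangle] by blast

lemma measurable_triangle_snd:
  fixes f :: "real \<Rightarrow> 'c::euclidean_space"
  assumes "f \<in> borel_measurable (lebesgue_on {c..d})"
  shows "(\<lambda>z. f (snd z)) \<in> borel_measurable (lebesgue_on (triangle c d))"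
proof -
  have "(\<lambda>x. if x \<in> {c..d} then f x else 0) \<in> borel_measurable lebesgue"
    using assms by (subst borel_measurable_if) auto
  from measurable_restrict_space1[OF measurable_lebesgue_snd[OF this]]
  show ?thesis
    by (rule measurable_cong[THEN iffD1, rotated]) (auto simp: space_restrict_space triangle_def)
qed

lemma AE_triangle_slice:
  assumes "AE z in lebesgue_on (triangle c d). P (fst z) (snd z)"
  shows "AE t in lebesgue_on {c..d}. AE \<tau> in lebesgue_on {c..t}. P t \<tau>"
proof -
  have "AE z in lebesgue. z \<in> triangle c d \<longrightarrow> P (fst z) (snd z)"
    using assms by (simp add: AE_restrict_space_iff)
  from AE_lebesgue_slice[OF this] show ?thesis
    by (auto simp: AE_restrict_space_iff triangle_def elim!: eventually_mono)
qed

lemma AE_triangle_snd: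
  assumes "AE t in lebesgue_on {c..d}. P t"
  shows "AE z in lebesgue_on (triangle c d). P (snd z)"
proof -
  have "AE t in lebesgue. t \<in> {c..d} \<longrightarrow> P t"
    using assms by (simp add: AE_restrict_space_iff)
  then show ?thesis
    unfolding AE_lebesgue_on_iff[OF triangle_sets]
    by (rule eventually_mono[OF AE_lebesgue_snd]) (auto simp: triangle_def)
qed

text \<open>Fubini for a bounded integrand on the triangle. The inner integral is that of a Borel representative
  for almost every \<open>t\<close>, which gives measurability in \<open>t\<close> because Lebesgue measure is complete.\<close>

lemma
  fixes f :: "real \<Rightarrow> real \<Rightarrow> 'b::euclidean_space"
  assumes meas: "(\<lambda>z. f (fst z) (snd z)) \<in> borel_measurable (lebesgue_on (triangle c d))"
    and bound: "AE z in lebesgue_on (triangle c d). norm (f (fst z) (snd z)) \<le> B"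
  shows AE_integrable_triangle:
      "AE t in lebesgue_on {c..d}. integrable (lebesgue_on {c..t}) (f t)"
    and measurable_integral_triangle:
      "(\<lambda>t. LINT \<tau>|lebesgue_on {c..t}. f t \<tau>) \<in> borel_measurable (lebesgue_on {c..d})"
proof -
  define F where "F z = (if z \<in> triangle c d then f (fst z) (snd z) else 0)" for z
  have F: "F \<in> borel_measurable lebesgue"
    unfolding F_def using meas by (subst borel_measurable_if) auto
  have "AE z in lebesgue. z \<in> triangle c d \<longrightarrow> norm (F z) \<le> B"
    using bound by (simp add: AE_restrict_space_iff F_def)
  moreover have "emeasure lebesgue (triangle c d) < \<infinity>"
    using lmeasurable_compact[OF compact_triangle] by (auto simp: fmeasurable_def)
  ultimately have int: "integrable lebesgue F"
    using F by (intro integrableI_bounded_set[of "triangle c d" _ _ B]) (auto simp: F_def)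
  obtain F' where F': "F' \<in> borel_measurable borel" "AE z in lebesgue. F z = F' z"
    using ex_borel_representative[OF F] .
  then have "integrable lebesgue F'"
    using int F integrable_cong_AE[OF F measurable_completion, of F'] by simp
  then have F'int: "integrable (lborel \<Otimes>\<^sub>M lborel) F'"
    using F'(1) by (simp add: integrable_completion lborel_prod)
  have slice: "(\<lambda>\<tau>. F (t, \<tau>)) = (\<lambda>\<tau>. if \<tau> \<in> {c..t} then f t \<tau> else 0)" if "t \<in> {c..d}" for t
    using that by (auto simp: F_def triangle_def)
  have key: "AE t in lebesgue_on {c..d}. integrable (lebesgue_on {c..t}) (f t) \<and>
      (\<integral>\<tau>. F' (t, \<tau>) \<partial>lborel) = (LINT \<tau>|lebesgue_on {c..t}. f t \<tau>)"
    using AE_completion[OF lborel_pair.AE_integrable_fst'[OF F'int]] AE_lebesgue_slice[OF F'(2)]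
    unfolding AE_lebesgue_on_iff[OF atLeastAtMost_sets_lebesgue]
  proof eventually_elim
    case (elim t)
    show ?case
    proof 
      assume t: "t \<in> {c..d}"
      have m: "(\<lambda>\<tau>. F' (t, \<tau>)) \<in> borel_measurable lborel"
        using elim(1) by (rule borel_measurable_integrable)
      have F't: "(\<lambda>\<tau>. F' (t, \<tau>)) \<in> borel_measurable lebesgue"
        using m by (rule measurable_completion)
      have i: "integrable lebesgue (\<lambda>\<tau>. F' (t, \<tau>))"
        using elim(1) m by (simp add: integrable_completion)
      have eq: "AE \<tau> in lebesgue. F' (t, \<tau>) = F (t, \<tau>)"
        using elim(2) by (rule eventually_mono) simp
      have Ft: "(\<lambda>\<tau>. F (t, \<tau>)) \<in> borel_measurable lebesgue"
        using F't eq by (rule borel_measurable_AE)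
      have "integrable lebesgue (\<lambda>\<tau>. F (t, \<tau>))"
        using integrable_cong_AE[OF F't Ft eq] i by (rule iffD1)
      moreover have "(\<integral>\<tau>. F' (t, \<tau>) \<partial>lborel) = (\<integral>\<tau>. F (t, \<tau>) \<partial>lebesgue)"
        using integral_completion[OF m] integral_cong_AE[OF F't Ft eq] by simp
      ultimately show "integrable (lebesgue_on {c..t}) (f t) \<and>
          (\<integral>\<tau>. F' (t, \<tau>) \<partial>lborel) = (LINT \<tau>|lebesgue_on {c..t}. f t \<tau>)"
        unfolding slice[OF t] Lebesgue_Measure.integrable_restrict_UNIV[OF atLeastAtMost_sets_lebesgue]
          Lebesgue_Measure.integral_restrict_UNIV[OF atLeastAtMost_sets_lebesgue] by blast
    qed
  qed
  then show "AE t in lebesgue_on {c..d}. integrable (lebesgue_on {c..t}) (f t)"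
    by (rule eventually_mono) simp
  have m: "(\<lambda>t. \<integral>\<tau>. F' (t, \<tau>) \<partial>lborel) \<in> borel_measurable borel"
    using borel_measurable_integrable[OF lborel_pair.integrable_fst'[OF F'int]] by simp
  have "(\<lambda>t. if t \<in> {c..d} then \<integral>\<tau>. F' (t, \<tau>) \<partial>lborel else 0) \<in> borel_measurable borel"
    by (intro measurable_If_set m) auto
  then have "(\<lambda>t. if t \<in> {c..d} then \<integral>\<tau>. F' (t, \<tau>) \<partial>lborel else 0) \<in> borel_measurable lebesgue"
    by (intro measurable_completion) simp
  moreover have "AE t in lebesgue. (if t \<in> {c..d} then \<integral>\<tau>. F' (t, \<tau>) \<partial>lborel else 0) =
      (if t \<in> {c..d} then LINT \<tau>|lebesgue_on {c..t}. f t \<tau> else 0)"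
    using key unfolding AE_lebesgue_on_iff[OF atLeastAtMost_sets_lebesgue]
    by (rule eventually_mono) simp
  ultimately have "(\<lambda>t. if t \<in> {c..d} then LINT \<tau>|lebesgue_on {c..t}. f t \<tau> else 0) \<in> borel_measurable lebesgue"
    by (rule borel_measurable_AE)
  then show "(\<lambda>t. LINT \<tau>|lebesgue_on {c..t}. f t \<tau>) \<in> borel_measurable (lebesgue_on {c..d})"
    by (subst (asm) borel_measurable_if) auto
qed

section \<open>Integrals over subintervals\<close>

lemma AE_lebesgue_on_subset:
  assumes "AE x in lebesgue_on T. P x" "S \<subseteq> T" "S \<in> sets lebesgue" "T \<in> sets lebesgue"
  shows "AE x in lebesgue_on S. P x"
  unfolding AE_lebesgue_on_iff[OF assms(3)]
proof (rule eventually_mono)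
  show "AE x in lebesgue. x \<in> T \<longrightarrow> P x"
    using assms(1) unfolding AE_lebesgue_on_iff[OF assms(4)] .
qed (use assms(2) in blast)

lemma AE_interval_subset:
  assumes "AE t in lebesgue_on {c..d::real}. P t" "c \<le> c'" "d' \<le> d"
  shows "AE t in lebesgue_on {c'..d'}. P t"
proof -
  have "{c'..d'} \<subseteq> {c..d}" using assms(2,3) by auto
  then show ?thesis by (rule AE_lebesgue_on_subset[OF assms(1)]) simp_all
qed

lemma measurable_interval_subset:
  assumes "f \<in> borel_measurable (lebesgue_on {c..d::real})" "c \<le> c'" "d' \<le> d"
  shows "f \<in> borel_measurable (lebesgue_on {c'..d'})"
proof -
  have "{c'..d'} \<subseteq> {c..d}" using assms(2,3) by auto
  then show ?thesis by (rule measurable_restrict_mono[OF assms(1)])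
qed

lemma integrable_interval:
  fixes f :: "real \<Rightarrow> 'b::euclidean_space"
  assumes "f \<in> borel_measurable (lebesgue_on {c..d})" "AE t in lebesgue_on {c..d}. norm (f t) \<le> B"
    and "c \<le> c'" "d' \<le> d"
  shows "integrable (lebesgue_on {c'..d'}) f"
proof -
  interpret finite_measure "lebesgue_on {c'..d'}"
    by (intro finite_measureI) (simp add: emeasure_restrict_space emeasure_lborel_Icc_eq)
  show ?thesis
    using AE_interval_subset[OF assms(2-4)] measurable_interval_subset[OF assms(1,3,4)]
    by (rule integrable_const_bound)
qed

lemma integrable_lebesgue_on_subset:
  fixes f :: "'a::euclidean_space \<Rightarrow> 'b::euclidean_space"
  assumes "integrable (lebesgue_on T) f" "S \<subseteq> T" "S \<in> sets lebesgue" "T \<in> sets lebesgue"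
  shows "integrable (lebesgue_on S) f"
proof -
  have "integrable lebesgue (\<lambda>x. if x \<in> T then f x else 0)"
    using assms(1) by (simp add: Lebesgue_Measure.integrable_restrict_UNIV[OF assms(4)])
  from integrable_mult_indicator[OF assms(3) this]
  have "integrable lebesgue (\<lambda>x. indicator S x *\<^sub>R (if x \<in> T then f x else 0))" .
  also have "(\<lambda>x. indicator S x *\<^sub>R (if x \<in> T then f x else 0)) = (\<lambda>x. if x \<in> S then f x else 0)"
    using assms(2) by (intro ext) (auto simp: indicator_def)
  finally show ?thesis
    by (simp add: Lebesgue_Measure.integrable_restrict_UNIV[OF assms(3)])
qed

lemma LINT_interval_combine:
  fixes f :: "real \<Rightarrow> 'b::euclidean_space"
  assumes "integrable (lebesgue_on {a..c}) f" "a \<le> b" "b \<le> c"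
  shows "(LINT t|lebesgue_on {a..c}. f t) = (LINT t|lebesgue_on {a..b}. f t) + (LINT t|lebesgue_on {b..c}. f t)"
proof -
  have "{a..b} \<subseteq> {a..c}" "{b..c} \<subseteq> {a..c}" using assms by auto
  then have int: "integrable (lebesgue_on {a..b}) f" "integrable (lebesgue_on {b..c}) f"
    using integrable_lebesgue_on_subset[OF assms(1)] by simp_all
  have "integral {a..b} f + integral {b..c} f = integral {a..c} f"
    using assms by (intro Henstock_Kurzweil_Integration.integral_combine integrable_on_lebesgue_on) auto
  then show ?thesis
    using assms(1) int by (simp add: lebesgue_integral_eq_integral)
qed

lemma LINT_interval_power:
  fixes c t :: real
  assumes "c \<le> t"
  shows "(LINT \<tau>|lebesgue_on {c..t}. (\<tau> - c) ^ k) = (t - c) ^ Suc k / Suc k"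
proof -
  have "integrable (lebesgue_on {c..t}) (\<lambda>\<tau>. (\<tau> - c) ^ k)"
    by (intro continuous_imp_integrable_real continuous_intros)
  then have "(LINT \<tau>|lebesgue_on {c..t}. (\<tau> - c) ^ k) = integral {c..t} (\<lambda>\<tau>. (\<tau> - c) ^ k)"
    by (rule lebesgue_integral_eq_integral) simp
  also have "((\<lambda>\<tau>. (\<tau> - c) ^ k) has_integral ((t - c) ^ Suc k / Suc k - (c - c) ^ Suc k / Suc k)) {c..t}"
    using assms
    by (intro fundamental_theorem_of_calculus)
       (auto intro!: derivative_eq_intros simp: has_real_derivative_iff_has_vector_derivative[symmetric] simp del: power_Suc of_nat_Suc)
  then have "integral {c..t} (\<lambda>\<tau>. (\<tau> - c) ^ k) = (t - c) ^ Suc k / Suc k"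
    by (intro integral_unique) simp
  finally show ?thesis .
qed

section \<open>Essentially bounded functions\<close>

lemma Linf_norm_finite_imp_AE_bound:
  assumes "Linf_norm A f < \<infinity>"
  obtains C where "C \<ge> 0" "Linf_norm A f = ennreal C" "AE x in lebesgue_on A. norm (f x) \<le> C"
proof -
  obtain C where C: "C \<ge> 0" "Linf_norm A f = ennreal C"
    using assms by (cases "Linf_norm A f") auto
  have "AE x in lebesgue_on A. ennreal (norm (f x)) \<le> ennreal C"
    using esssup_AE[of "\<lambda>x. ennreal (norm (f x))" "lebesgue_on A"] C(2) by (simp add: Linf_norm_def)
  then have "AE x in lebesgue_on A. norm (f x) \<le> C"
    by (rule eventually_mono) (use C(1) in \<open>simp add: ennreal_le_iff\<close>)
  then show ?thesis using that C by blast
qed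

lemma Linf_norm_le:
  fixes f :: "'a::euclidean_space \<Rightarrow> 'b::real_normed_vector"
  assumes "f \<in> borel_measurable (lebesgue_on A)" "AE x in lebesgue_on A. norm (f x) \<le> C"
  shows "Linf_norm A f \<le> ennreal C"
  unfolding Linf_norm_def
proof (rule esssup_I)
  show "(\<lambda>x. ennreal (norm (f x))) \<in> borel_measurable (lebesgue_on A)"
    using assms(1) by measurable
  show "AE x in lebesgue_on A. ennreal (norm (f x)) \<le> ennreal C"
    using assms(2) by (rule eventually_mono) (rule ennreal_leI)
qed

lemma LinfI:
  assumes "f \<in> borel_measurable (lebesgue_on A)" "AE x in lebesgue_on A. norm (f x) \<le> C"
  shows "f \<in> Linf A"
  using assms Linf_norm_le[OF assms] by (auto simp: Linf_def intro: le_less_trans)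

lemma LinfE:
  assumes "f \<in> Linf A"
  obtains C where "f \<in> borel_measurable (lebesgue_on A)" "C \<ge> 0" "Linf_norm A f = ennreal C"
    "AE x in lebesgue_on A. norm (f x) \<le> C"
  using assms Linf_norm_finite_imp_AE_bound[of A f] by (auto simp: Linf_def)

lemma Linf_measurable: "f \<in> Linf A \<Longrightarrow> f \<in> borel_measurable (lebesgue_on A)"
  by (simp add: Linf_def)

lemma Linf_add:
  fixes f g :: "'a::euclidean_space \<Rightarrow> 'b::euclidean_space"
  assumes f: "f \<in> Linf A" and g: "g \<in> Linf A"
  shows "(\<lambda>x. f x + g x) \<in> Linf A"
proof -
  from f obtain C where C: "AE x in lebesgue_on A. norm (f x) \<le> C" by (rule LinfE)
  from g obtain D where D: "AE x in lebesgue_on A. norm (g x) \<le> D" by (rule LinfE)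
  show ?thesis
  proof (rule LinfI)
    show "(\<lambda>x. f x + g x) \<in> borel_measurable (lebesgue_on A)"
      using f g by (intro borel_measurable_add Linf_measurable)
    show "AE x in lebesgue_on A. norm (f x + g x) \<le> C + D"
      using C D by eventually_elim (rule norm_triangle_mono)
  qed
qed

lemma Linf_scaleR:
  fixes f :: "'a::euclidean_space \<Rightarrow> 'b::euclidean_space"
  assumes f: "f \<in> Linf A"
  shows "(\<lambda>x. r *\<^sub>R f x) \<in> Linf A"
proof -
  from f obtain C where C: "AE x in lebesgue_on A. norm (f x) \<le> C" by (rule LinfE)
  show ?thesis
  proof (rule LinfI)
    show "(\<lambda>x. r *\<^sub>R f x) \<in> borel_measurable (lebesgue_on A)"
      using f by (intro borel_measurable_scaleR borel_measurable_const Linf_measurable)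
    show "AE x in lebesgue_on A. norm (r *\<^sub>R f x) \<le> \<bar>r\<bar> * C"
      using C by eventually_elim (simp add: mult_left_mono)
  qed
qed

lemma Linf_diff:
  fixes f g :: "'a::euclidean_space \<Rightarrow> 'b::euclidean_space"
  assumes f: "f \<in> Linf A" and g: "g \<in> Linf A"
  shows "(\<lambda>x. f x - g x) \<in> Linf A"
  using Linf_add[OF f Linf_scaleR[OF g, of "-1"]] by simp

lemma Linf_minus:
  fixes f :: "'a::euclidean_space \<Rightarrow> 'b::euclidean_space"
  assumes "f \<in> Linf A"
  shows "(\<lambda>x. - f x) \<in> Linf A"
  using Linf_scaleR[OF assms, of "-1"] by simp

lemma Linf_cong_AE:
  fixes f g :: "'a::euclidean_space \<Rightarrow> 'b::euclidean_space"
  assumes f: "f \<in> Linf S" and eq: "AE t in lebesgue_on S. f t = g t" and S: "S \<in> sets lebesgue"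
  shows "g \<in> Linf S"
proof -
  from f obtain C where C: "AE x in lebesgue_on S. norm (f x) \<le> C" by (rule LinfE)
  show ?thesis
  proof (rule LinfI)
    show "g \<in> borel_measurable (lebesgue_on S)"
      using Linf_measurable[OF f] eq S by (rule borel_measurable_lebesgue_on_AE)
    show "AE x in lebesgue_on S. norm (g x) \<le> C"
      using C eq by eventually_elim simp
  qed
qed

lemma Linf_subset_interval:
  fixes f :: "real \<Rightarrow> 'b::euclidean_space"
  assumes f: "f \<in> Linf {c..d}" and "c \<le> c'" "d' \<le> d"
  shows "f \<in> Linf {c'..d'}"
proof -
  from f obtain C where C: "AE x in lebesgue_on {c..d}. norm (f x) \<le> C" by (rule LinfE)
  show ?thesis
    by (rule LinfI[OF measurable_interval_subset[OF Linf_measurable[OF f] assms(2,3)] AE_interval_subset[OF C assms(2,3)]])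
qed

lemma Linf_integrable:
  fixes f :: "real \<Rightarrow> 'b::euclidean_space"
  assumes f: "f \<in> Linf {c..d}" and "c \<le> c'" "d' \<le> d"
  shows "integrable (lebesgue_on {c'..d'}) f"
proof -
  from f obtain C where C: "AE x in lebesgue_on {c..d}. norm (f x) \<le> C" by (rule LinfE)
  show ?thesis
    by (rule integrable_interval[OF Linf_measurable[OF f] C assms(2,3)])
qed

lemma LINT_norm_le:
  fixes f :: "real \<Rightarrow> 'b::euclidean_space"
  assumes "f \<in> borel_measurable (lebesgue_on {c..d})" "AE t in lebesgue_on {c..d}. norm (f t) \<le> C"
    and t: "t \<in> {c..d}"
  shows "(LINT \<tau>|lebesgue_on {c..t}. norm (f \<tau>)) \<le> C * (t - c)"
proof -
  have "(LINT \<tau>|lebesgue_on {c..t}. norm (f \<tau>)) \<le> (LINT \<tau>|lebesgue_on {c..t}. C * (\<tau> - c) ^ 0)"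
  proof (rule Bochner_Integration.integral_mono_AE)
    show "integrable (lebesgue_on {c..t}) (\<lambda>\<tau>. norm (f \<tau>))"
      using assms by (intro integrable_norm integrable_interval) auto
    show "integrable (lebesgue_on {c..t}) (\<lambda>\<tau>. C * (\<tau> - c) ^ 0)"
      by (intro continuous_imp_integrable_real continuous_intros)
    show "AE \<tau> in lebesgue_on {c..t}. norm (f \<tau>) \<le> C * (\<tau> - c) ^ 0"
      using AE_interval_subset[OF assms(2), of c t] t by simp
  qed
  also have "\<dots> = C * (t - c)"
    using LINT_interval_power[of c t 0] t by simp
  finally show ?thesis .
qed

text \<open>Spaces over an open interval and over its closure are identified, so that one can work on
  compact intervals, on which the curves are bounded.\<close>

lemma
  fixes c d :: real
  shows open_interval_eq_closed_diff_null: "{c<..<d} = {c..d} - {c, d} \<inter> {c..d}"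
    and endpoints_null: "{c, d} \<inter> {c..d} \<in> null_sets (lebesgue_on {c..d})"
proof -
  show "{c<..<d} = {c..d} - {c, d} \<inter> {c..d}" by auto
  have "{c, d} \<inter> {c..d} \<in> null_sets lebesgue"
    by (intro null_sets_completionI finite_imp_null_set_lborel) auto
  then show "{c, d} \<inter> {c..d} \<in> null_sets (lebesgue_on {c..d})"
    by (subst null_sets_restrict_space) auto
qed

lemma AE_open_interval_iff:
  fixes c d :: real
  shows "(AE t in lebesgue_on {c<..<d}. P t) \<longleftrightarrow> (AE t in lebesgue_on {c..d}. P t)"
proof
  assume *: "AE t in lebesgue_on {c<..<d}. P t"
  have "AE t in lebesgue. t \<notin> {c, d}"
    by (intro AE_not_in null_sets_completionI finite_imp_null_set_lborel) auto
  moreover have "AE t in lebesgue. t \<in> {c<..<d} \<longrightarrow> P t"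
    using * by (simp add: AE_lebesgue_on_iff)
  ultimately show "AE t in lebesgue_on {c..d}. P t"
    unfolding AE_lebesgue_on_iff[OF atLeastAtMost_sets_lebesgue] by eventually_elim auto
next
  assume *: "AE t in lebesgue_on {c..d}. P t"
  show "AE t in lebesgue_on {c<..<d}. P t"
    by (rule AE_lebesgue_on_subset[OF *]) auto
qed

lemma measurable_open_interval_iff:
  fixes f :: "real \<Rightarrow> 'b::euclidean_space"
  shows "f \<in> borel_measurable (lebesgue_on {c<..<d}) \<longleftrightarrow> f \<in> borel_measurable (lebesgue_on {c..d})"
  unfolding open_interval_eq_closed_diff_null
  by (rule borel_measurable_diff_null[OF endpoints_null]) simp

lemma Linf_norm_open_interval:
  fixes f :: "real \<Rightarrow> 'b::euclidean_space"
  assumes "f \<in> borel_measurable (lebesgue_on {c..d})"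
  shows "Linf_norm {c<..<d} f = Linf_norm {c..d} f"
proof -
  have "(\<lambda>x. ennreal (norm (f x))) \<in> borel_measurable (lebesgue_on {c<..<d})"
    "(\<lambda>x. ennreal (norm (f x))) \<in> borel_measurable (lebesgue_on {c..d})"
    using assms measurable_open_interval_iff[of f c d] by simp_all
  then show ?thesis
    unfolding Linf_norm_def by (simp add: esssup_eq_AE AE_open_interval_iff)
qed

lemma Linf_open_interval:
  "(Linf {c<..<d} :: (real \<Rightarrow> 'b::euclidean_space) set) = Linf {c..d}"
proof -
  have "f \<in> Linf {c<..<d} \<longleftrightarrow> f \<in> Linf {c..d}" for f :: "real \<Rightarrow> 'b"
    using Linf_norm_open_interval[of f c d] by (auto simp: Linf_def measurable_open_interval_iff)
  then show ?thesis by blast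
qed

section \<open>Functions of time and state along a curve\<close>

text \<open>By Fubini the section at \<open>x\<close> is measurable for almost every \<open>x\<close>, hence for \<open>x\<close> in a dense set, and
  continuity in \<open>x\<close> extends this to every \<open>x\<close>.\<close>

lemma measurable_tx_section:
  fixes h :: "real \<Rightarrow> 'a::euclidean_space \<Rightarrow> 'b::euclidean_space"
  assumes "measurable_tx h" and cont: "\<forall>t. continuous_on UNIV (h t)"
  shows "(\<lambda>t. h t y) \<in> borel_measurable lebesgue"
proof -
  define good where "good = {x. (\<lambda>t. h t x) \<in> borel_measurable lebesgue}"
  have "(\<lambda>(t, x). h t x) \<in> borel_measurable lebesgue"
    using assms(1) by (simp add: measurable_tx_def)
  then obtain h' where h': "h' \<in> borel_measurable borel" "AE z in lebesgue. (\<lambda>(t, x). h t x) z = h' z"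
    by (rule ex_borel_representative)
  have "AE x in lebesgue. AE t in lebesgue. h' (t, x) = h t x"
    using AE_lebesgue_slice_swap[OF h'(2)] by (simp add: eq_commute)
  then have "AE x in lebesgue. x \<in> closure good"
  proof eventually_elim
    case (elim x)
    have "(\<lambda>t. h' (t, x)) \<in> borel_measurable lebesgue"
      using h'(1) by (intro measurable_completion) (simp add: measurable_compose[of "\<lambda>t. (t, x)", OF borel_measurable_Pair])
    then have "(\<lambda>t. h t x) \<in> borel_measurable lebesgue"
      using elim by (rule borel_measurable_AE)
    then show ?case
      using closure_subset[of good] by (auto simp: good_def)
  qed
  then have "y \<in> closure good"
    by (intro mem_closed_if_AE_lebesgue) auto
  then obtain X where X: "\<And>n. X n \<in> good" "X \<longlonglongrightarrow> y"
    by (auto simp: closure_sequential)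
  show ?thesis
  proof (rule borel_measurable_LIMSEQ_metric)
    show "(\<lambda>t. h t (X i)) \<in> borel_measurable lebesgue" for i
      using X(1) by (simp add: good_def)
    show "(\<lambda>i. h t (X i)) \<longlonglongrightarrow> h t y" for t
      using cont X(2) continuous_on_tendsto_compose[of UNIV "h t" X y] by auto
  qed
qed

text \<open>The argument of Caratheodory: freezing the curve at the last multiple of \<open>1 / (n + 1)\<close> leaves
  countably many sections, and the frozen functions converge as \<open>n\<close> grows.\<close>

lemma measurable_tx_along_curve:
  fixes h :: "real \<Rightarrow> 'a::euclidean_space \<Rightarrow> 'b::euclidean_space"
  assumes h: "measurable_tx h" "\<forall>t. continuous_on UNIV (h t)"
    and x: "continuous_on {c..d} x"
  shows "(\<lambda>t. h t (x t)) \<in> borel_measurable (lebesgue_on {c..d})"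
proof (cases "c \<le> d")
  case False
  then show ?thesis by (simp add: measurable_def space_restrict_space)
next
  case True
  define X where "X t = x (max c (min d t))" for t
  have X: "continuous_on UNIV X"
    unfolding X_def using True
    by (intro continuous_on_compose2[OF x]) (auto intro!: continuous_intros)
  define r where "r n t = of_int \<lfloor>real (Suc n) * t\<rfloor> / real (Suc n)" for n and t :: real
  have lim: "(\<lambda>n. r n t) \<longlonglongrightarrow> t" for t
  proof (rule metric_LIMSEQ_I)
    fix e :: real assume "e > 0"
    then obtain N where N: "inverse (real (Suc N)) < e"
      using reals_Archimedean by blast
    have "dist (r n t) t < e" if "n \<ge> N" for n
    proof -
      have "real_of_int \<lfloor>real (Suc n) * t\<rfloor> \<le> real (Suc n) * t" 
        "real (Suc n) * t < real_of_int \<lfloor>real (Suc n) * t\<rfloor> + 1"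
        by linarith+
      then have "r n t \<le> t" "t \<le> (of_int \<lfloor>real (Suc n) * t\<rfloor> + 1) / real (Suc n)"
        unfolding r_def by (simp_all add: pos_divide_le_eq pos_le_divide_eq mult.commute del: of_nat_Suc)
      then have "r n t \<le> t" "t - r n t \<le> inverse (real (Suc n))"
        unfolding r_def by (simp_all add: add_divide_distrib inverse_eq_divide del: of_nat_Suc)
      moreover have "inverse (real (Suc n)) \<le> inverse (real (Suc N))"
        using that by (intro le_imp_inverse_le) auto
      ultimately show ?thesis
        unfolding dist_real_def using N by linarith
    qed
    then show "\<exists>N. \<forall>n\<ge>N. dist (r n t) t < e" by blast
  qed
  have "(\<lambda>t. h t (X t)) \<in> borel_measurable lebesgue"
  proof (rule borel_measurable_LIMSEQ_metric)
    fix n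
    have "(\<lambda>t. h t (X (of_int k / real (Suc n)))) \<in> borel_measurable lebesgue" for k :: int
      using h by (rule measurable_tx_section)
    moreover have "(\<lambda>t. \<lfloor>real (Suc n) * t\<rfloor>) \<in> measurable lebesgue (count_space UNIV)"
      by (intro measurable_completion) measurable
    ultimately show "(\<lambda>t. h t (X (r n t))) \<in> borel_measurable lebesgue"
      unfolding r_def by (rule measurable_compose_countable)
  next
    fix t
    have "(\<lambda>n. X (r n t)) \<longlonglongrightarrow> X t"
      using X lim continuous_on_tendsto_compose[of UNIV X "\<lambda>n. r n t" t] by auto
    then show "(\<lambda>n. h t (X (r n t))) \<longlonglongrightarrow> h t (X t)"
      using h(2) continuous_on_tendsto_compose[of UNIV "h t" "\<lambda>n. X (r n t)" "X t"] by auto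
  qed
  from measurable_restrict_space1[OF this, of "{c..d}"] show ?thesis
    by (rule measurable_cong[THEN iffD1, rotated]) (auto simp: X_def space_restrict_space)
qed

lemma locally_ess_bounded_tx_AE:
  fixes h :: "real \<Rightarrow> 'a::euclidean_space \<Rightarrow> 'b::euclidean_space"
  assumes "locally_ess_bounded_tx h"
  obtains C where "C \<ge> 0" "AE t in lebesgue_on {c..d}. AE y in lebesgue. y \<in> cball 0 R \<longrightarrow> norm (h t y) \<le> C"
proof -
  let ?K = "{c..d} \<times> cball (0::'a) R"
  have K: "compact ?K" by (intro compact_Times) auto
  then have "Linf_norm ?K (\<lambda>(t, x). h t x) < \<infinity>"
    using assms by (auto simp: locally_ess_bounded_tx_def locally_ess_bounded_on_def)
  then obtain C where C: "C \<ge> 0" "AE z in lebesgue_on ?K. norm ((\<lambda>(t, x). h t x) z) \<le> C"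
    by (rule Linf_norm_finite_imp_AE_bound)
  have "?K \<in> sets lebesgue"
    using lmeasurable_compact[OF K] by blast
  with C(2) have "AE z in lebesgue. z \<in> ?K \<longrightarrow> norm ((\<lambda>(t, x). h t x) z) \<le> C"
    by (simp add: AE_lebesgue_on_iff)
  then have "AE t in lebesgue. AE y in lebesgue. (t, y) \<in> ?K \<longrightarrow> norm ((\<lambda>(t, x). h t x) (t, y)) \<le> C"
    by (rule AE_lebesgue_slice)
  then have "AE t in lebesgue_on {c..d}. AE y in lebesgue. y \<in> cball 0 R \<longrightarrow> norm (h t y) \<le> C"
    unfolding AE_lebesgue_on_iff[OF atLeastAtMost_sets_lebesgue]
    by (rule eventually_mono) (auto elim: eventually_mono)
  with C(1) show ?thesis by (rule that)
qed

text \<open>A closed condition that holds almost everywhere on an open set holds everywhere on it. The larger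
  radius provides an open ball around the closed one.\<close>

lemma locally_ess_bounded_tx_continuous:
  fixes h :: "real \<Rightarrow> 'a::euclidean_space \<Rightarrow> 'b::euclidean_space"
  assumes "locally_ess_bounded_tx h" and cont: "AE t in lebesgue. continuous_on UNIV (h t)"
  obtains C where "C \<ge> 0" "AE t in lebesgue_on {c..d}. \<forall>y\<in>cball 0 R. norm (h t y) \<le> C"
proof -
  obtain C where C: "C \<ge> 0"
      "AE t in lebesgue_on {c..d}. AE y in lebesgue. y \<in> cball 0 (R + 1) \<longrightarrow> norm (h t y) \<le> C"
    using assms(1) by (rule locally_ess_bounded_tx_AE)
  have "AE t in lebesgue_on {c..d}. continuous_on UNIV (h t)"
    using cont unfolding AE_lebesgue_on_iff[OF atLeastAtMost_sets_lebesgue] by (rule eventually_mono) simp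
  with C(2) have "AE t in lebesgue_on {c..d}. \<forall>y\<in>cball 0 R. norm (h t y) \<le> C"
  proof eventually_elim
    case (elim t)
    have "closed {y. norm (h t y) \<le> C}"
      using elim(2) by (intro closed_Collect_le continuous_intros)
    moreover have "AE y\<in>ball 0 (R + 1) in lebesgue. y \<in> {y. norm (h t y) \<le> C}"
      using elim(1) by (rule eventually_mono) auto
    ultimately show ?case
      using mem_closed_if_AE_lebesgue_open[of "ball 0 (R + 1)" "{y. norm (h t y) \<le> C}"] by auto
  qed
  with C(1) show ?thesis by (rule that)
qed

lemma locally_Lipschitz_tx_AE:
  fixes h :: "real \<Rightarrow> 'a::euclidean_space \<Rightarrow> 'b::euclidean_space"
  assumes "locally_Lipschitz_tx h"
  obtains L where "L \<ge> 0"
    "AE t in lebesgue_on {c..d}. \<forall>x\<in>cball 0 R. \<forall>y\<in>cball 0 R. norm (h t x - h t y) \<le> L * norm (x - y)"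
proof -
  obtain l :: "real \<Rightarrow> real" where l: "locally_ess_bounded_on UNIV l"
      "\<And>t x y. x \<in> cball 0 R \<Longrightarrow> y \<in> cball 0 R \<Longrightarrow> norm (h t x - h t y) \<le> l t * norm (x - y)"
    using assms unfolding locally_Lipschitz_tx_def by (meson compact_cball)
  have "Linf_norm {c..d} l < \<infinity>"
    using l(1) by (auto simp: locally_ess_bounded_on_def)
  then obtain L where L: "L \<ge> 0" "AE t in lebesgue_on {c..d}. norm (l t) \<le> L"
    by (rule Linf_norm_finite_imp_AE_bound)
  have "AE t in lebesgue_on {c..d}. \<forall>x\<in>cball 0 R. \<forall>y\<in>cball 0 R. norm (h t x - h t y) \<le> L * norm (x - y)"
    using L(2)
  proof (rule eventually_mono, intro ballI)
    fix t and x y :: 'a assume *: "norm (l t) \<le> L" "x \<in> cball 0 R" "y \<in> cball 0 R"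
    have "norm (h t x - h t y) \<le> l t * norm (x - y)"
      using * by (intro l(2))
    also have "\<dots> \<le> L * norm (x - y)"
      using *(1) by (intro mult_right_mono) auto
    finally show "norm (h t x - h t y) \<le> L * norm (x - y)" .
  qed
  with L(1) show ?thesis by (rule that)
qed

lemma continuous_curve_bounded:
  fixes x :: "real \<Rightarrow> 'a::euclidean_space"
  assumes "continuous_on {c..d} x"
  obtains R where "R > 0" "\<And>t. t \<in> {c..d} \<Longrightarrow> x t \<in> cball 0 R"
proof -
  have "bounded (x ` {c..d})"
    using assms by (intro compact_imp_bounded compact_continuous_image) auto
  then obtain R where "R > 0" "\<forall>y\<in>x ` {c..d}. norm y \<le> R"
    unfolding bounded_pos by blast
  then show ?thesis by (intro that[of R]) auto
qed

lemma locally_Lipschitz_along_curves: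
  fixes h :: "real \<Rightarrow> 'a::euclidean_space \<Rightarrow> 'b::euclidean_space"
  assumes h: "locally_Lipschitz_tx h" and x: "continuous_on {c..d} x" and y: "continuous_on {c..d} y"
  obtains L where "L \<ge> 0" "AE t in lebesgue_on {c..d}. norm (h t (x t) - h t (y t)) \<le> L * norm (x t - y t)"
proof -
  obtain R where R: "\<And>t. t \<in> {c..d} \<Longrightarrow> x t \<in> cball 0 R"
    using x by (rule continuous_curve_bounded) blast
  obtain R' where R': "\<And>t. t \<in> {c..d} \<Longrightarrow> y t \<in> cball 0 R'"
    using y by (rule continuous_curve_bounded) blast
  obtain L where L: "L \<ge> 0" "AE t in lebesgue_on {c..d}.
      \<forall>x\<in>cball 0 (max R R'). \<forall>y\<in>cball 0 (max R R'). norm (h t x - h t y) \<le> L * norm (x - y)"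
    using h by (rule locally_Lipschitz_tx_AE)
  have "AE t in lebesgue_on {c..d}. norm (h t (x t) - h t (y t)) \<le> L * norm (x t - y t)"
    using L(2) AE_space
  proof eventually_elim
    case (elim t)
    then have "t \<in> {c..d}" by simp
    from R[OF this] R'[OF this] have "x t \<in> cball 0 (max R R')" "y t \<in> cball 0 (max R R')" by auto
    with elim(1) show ?case by blast
  qed
  with L(1) show ?thesis by (rule that)
qed

lemma continuous_on_Linf:
  fixes f :: "real \<Rightarrow> 'b::euclidean_space"
  assumes "continuous_on {c..d} f"
  shows "f \<in> Linf {c..d}"
proof -
  obtain R where "\<And>t. t \<in> {c..d} \<Longrightarrow> f t \<in> cball 0 R"
    using assms by (rule continuous_curve_bounded) blast
  then show ?thesis
    by (intro LinfI[of _ _ R] AE_I2 continuous_imp_measurable_on_sets_lebesgue assms)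
       auto
qed

lemma Linf_along_curve:
  fixes h :: "real \<Rightarrow> 'a::euclidean_space \<Rightarrow> 'b::euclidean_space"
  assumes h: "measurable_tx h" "locally_ess_bounded_tx h" "\<forall>t. continuous_on UNIV (h t)"
    and x: "continuous_on {c..d} x"
  shows "(\<lambda>t. h t (x t)) \<in> Linf {c..d}"
proof -
  obtain R where R: "\<And>t. t \<in> {c..d} \<Longrightarrow> x t \<in> cball 0 R"
    using x by (rule continuous_curve_bounded) blast
  have "AE t in lebesgue. continuous_on UNIV (h t)" using h(3) by simp
  with h(2) obtain C where C: "AE t in lebesgue_on {c..d}. \<forall>y\<in>cball 0 R. norm (h t y) \<le> C"
    by (rule locally_ess_bounded_tx_continuous)
  show ?thesis
  proof (rule LinfI)
    show "(\<lambda>t. h t (x t)) \<in> borel_measurable (lebesgue_on {c..d})"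
      using h(1,3) x by (rule measurable_tx_along_curve)
    show "AE t in lebesgue_on {c..d}. norm (h t (x t)) \<le> C"
      using C AE_space by eventually_elim (use R in simp)
  qed
qed

section \<open>Matrices depending on a parameter\<close>

lemma norm_matrix_vector_mult_le:
  fixes A :: "real^'n^'m"
  shows "norm (A *v x) \<le> norm A * norm x"
proof -
  have "norm (A *v x) = L2_set (\<lambda>i. (A *v x) $ i) UNIV"
    by (simp add: norm_vec_def L2_set_def)
  also have "\<dots> = L2_set (\<lambda>i. \<bar>A $ i \<bullet> x\<bar>) UNIV"
    by (simp add: L2_set_def matrix_vector_mul_component)
  also have "\<dots> \<le> L2_set (\<lambda>i. norm (A $ i) * norm x) UNIV"
    by (intro L2_set_mono) (auto simp: Cauchy_Schwarz_ineq2)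
  also have "\<dots> = norm A * norm x"
    by (simp add: norm_vec_def L2_set_left_distrib)
  finally show ?thesis .
qed

lemma norm_matrix_vector_mult_bound:
  fixes A :: "real^'n^'m"
  assumes "norm A \<le> C" "norm x \<le> B"
  shows "norm (A *v x) \<le> C * B"
  using norm_matrix_vector_mult_le[of A x] mult_mono[OF assms] norm_ge_zero[of A] assms(1) by simp

lemma borel_measurable_matrix_vector_mult [measurable (raw)]:
  fixes A :: "'z \<Rightarrow> real^'n^'m"
  assumes "A \<in> borel_measurable M" "v \<in> borel_measurable M"
  shows "(\<lambda>z. A z *v v z) \<in> borel_measurable M"
  using assms
  by (rule borel_measurable_continuous_Pair) (auto simp: matrix_vector_mult_def intro!: continuous_intros)

lemma borel_measurable_matrix_matrix_mult [measurable (raw)]: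
  fixes A :: "'z \<Rightarrow> real^'n^'m" and B :: "'z \<Rightarrow> real^'k^'n"
  assumes "A \<in> borel_measurable M" "B \<in> borel_measurable M"
  shows "(\<lambda>z. A z ** B z) \<in> borel_measurable M"
  using assms
  by (rule borel_measurable_continuous_Pair) (auto simp: matrix_matrix_mult_def intro!: continuous_intros)

lemma Linf_matrix_vector_mult:
  fixes A :: "'a::euclidean_space \<Rightarrow> real^'n^'m"
  assumes A: "A \<in> Linf S" and v: "v \<in> Linf S"
  shows "(\<lambda>t. A t *v v t) \<in> Linf S"
proof -
  from A obtain C where C: "AE x in lebesgue_on S. norm (A x) \<le> C" by (rule LinfE)
  from v obtain D where D: "AE x in lebesgue_on S. norm (v x) \<le> D" by (rule LinfE)
  show ?thesis
  proof (rule LinfI)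
    show "(\<lambda>t. A t *v v t) \<in> borel_measurable (lebesgue_on S)"
      by (rule borel_measurable_matrix_vector_mult[OF Linf_measurable[OF A] Linf_measurable[OF v]])
    show "AE x in lebesgue_on S. norm (A x *v v x) \<le> C * D"
      using C D by eventually_elim (rule norm_matrix_vector_mult_bound)
  qed
qed

lemma continuous_on_matrix_matrix_mult:
  fixes A :: "'z::topological_space \<Rightarrow> real^'n^'m" and B :: "'z \<Rightarrow> real^'k^'n"
  assumes "continuous_on S A" "continuous_on S B"
  shows "continuous_on S (\<lambda>z. A z ** B z)"
  using assms by (auto simp: matrix_matrix_mult_def intro!: continuous_intros)

lemma continuous_on_det:
  fixes A :: "'z::topological_space \<Rightarrow> real^'n^'n"
  assumes "continuous_on S A"
  shows "continuous_on S (\<lambda>z. det (A z))"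
  using assms unfolding det_def by (intro continuous_intros)

lemma invertible_matrix_inv:
  fixes A :: "real^'n^'n"
  assumes "invertible A"
  shows invertible_matrix_inv_right: "A ** matrix_inv A = mat 1"
    and invertible_matrix_inv_left: "matrix_inv A ** A = mat 1"
  using someI_ex[of "\<lambda>A'. A ** A' = mat 1 \<and> A' ** A = mat 1"] assms
  unfolding invertible_def matrix_inv_def by auto

text \<open>Cramer's rule for the columns of the inverse. Unlike \<open>matrix_inv\<close>, which is an arbitrary choice on
  singular matrices, this is given by a formula everywhere and is therefore Borel measurable.\<close>

definition cofactor_inverse :: "real^'n^'n \<Rightarrow> real^'n^'n" where
  "cofactor_inverse A = (\<chi> i j. det (\<chi> k l. if l = i then axis j 1 $ k else A $ k $ l) / det A)"

lemma matrix_inv_eq_cofactor_inverse: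
  fixes A :: "real^'n^'n"
  assumes "invertible A"
  shows "matrix_inv A = cofactor_inverse A"
proof -
  have d: "det A \<noteq> 0" using assms by (simp add: invertible_det_nz)
  have "matrix_inv A $ i $ j = cofactor_inverse A $ i $ j" for i j
  proof -
    have "A *v (matrix_inv A *v axis j 1) = axis j 1"
      using invertible_matrix_inv_right[OF assms] by (simp add: matrix_vector_mul_assoc)
    then have "matrix_inv A *v axis j 1 = (\<chi> i. det (\<chi> k l. if l = i then axis j 1 $ k else A $ k $ l) / det A)"
      using cramer[OF d] by blast
    then show ?thesis
      by (simp add: matrix_vector_mult_basis column_def cofactor_inverse_def vec_eq_iff)
  qed
  then show ?thesis by (simp add: vec_eq_iff)
qed

lemma continuous_on_matrix_inv:
  fixes A :: "'z::topological_space \<Rightarrow> real^'n^'n"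
  assumes "continuous_on S A" "\<And>z. z \<in> S \<Longrightarrow> invertible (A z)"
  shows "continuous_on S (\<lambda>z. matrix_inv (A z))"
proof -
  have *: "continuous_on S (\<lambda>z. \<chi> k l. if l = i then axis j 1 $ k else A z $ k $ l)" for i j
  proof (intro continuous_on_vec_lambda)
    fix k l show "continuous_on S (\<lambda>z. if l = i then axis j 1 $ k else A z $ k $ l)"
      using assms(1) by (cases "l = i") (auto intro!: continuous_intros)
  qed
  have "continuous_on S (\<lambda>z. cofactor_inverse (A z))"
    unfolding cofactor_inverse_def
    using assms by (intro continuous_on_vec_lambda continuous_on_divide continuous_on_det *)
      (auto simp: invertible_det_nz)
  then show ?thesis
    using assms(2) by (simp add: matrix_inv_eq_cofactor_inverse cong: continuous_on_cong)
qed

lemma borel_measurable_matrix_inv: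
  fixes A :: "'a::euclidean_space \<Rightarrow> real^'n^'n"
  assumes A: "A \<in> borel_measurable (lebesgue_on S)"
    and inv: "AE t in lebesgue_on S. invertible (A t)" and S: "S \<in> sets lebesgue"
  shows "(\<lambda>t. matrix_inv (A t)) \<in> borel_measurable (lebesgue_on S)"
proof (rule borel_measurable_lebesgue_on_AE[OF _ _ S])
  have det: "(\<lambda>t. det (B t)) \<in> borel_measurable (lebesgue_on S)"
    if "B \<in> borel_measurable (lebesgue_on S)" for B :: "'a \<Rightarrow> real^'n^'n"
    using borel_measurable_continuous_onI[OF continuous_on_det[OF continuous_on_id]] that
    by (rule measurable_compose[rotated])
  have "(\<lambda>t. \<chi> k l. if l = i then axis j 1 $ k else A t $ k $ l) \<in> borel_measurable (lebesgue_on S)" for i j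
  proof -
    have "continuous_on UNIV (\<lambda>A::real^'n^'n. \<chi> k l. if l = i then axis j 1 $ k else A $ k $ l)"
    proof (intro continuous_on_vec_lambda)
      fix k l show "continuous_on UNIV (\<lambda>A::real^'n^'n. if l = i then axis j 1 $ k else A $ k $ l)"
        by (cases "l = i") (auto intro!: continuous_intros)
    qed
    from borel_measurable_continuous_onI[OF this] show ?thesis
      using A by (rule measurable_compose[rotated])
  qed
  with A have entries: "(\<lambda>t. cofactor_inverse (A t) $ i $ j) \<in> borel_measurable (lebesgue_on S)" for i j
    unfolding cofactor_inverse_def using det[OF A] det by (simp add: borel_measurable_divide)
  show "(\<lambda>t. cofactor_inverse (A t)) \<in> borel_measurable (lebesgue_on S)"
    using entries by (subst borel_measurable_euclidean_space) (auto simp: Basis_vec_def inner_axis)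
  show "AE t in lebesgue_on S. cofactor_inverse (A t) = matrix_inv (A t)"
    using inv by (rule eventually_mono) (simp add: matrix_inv_eq_cofactor_inverse)
qed

section \<open>Absolutely continuous curves\<close>

lemma absolutely_continuous_fun_on_imp_continuous_on:
  fixes f :: "real \<Rightarrow> 'a::real_normed_vector"
  assumes "absolutely_continuous_fun_on {a..b} f"
  shows "continuous_on {a..b} f"
  unfolding continuous_on_iff
proof (intro ballI allI impI)
  fix t e :: real assume t: "t \<in> {a..b}" and "e > 0"
  then obtain \<delta> where \<delta>: "\<delta> > 0" and ac: "\<And>P :: (real \<times> real) set. finite P \<Longrightarrow> (\<forall>(c, d) \<in> P. c \<le> d \<and> {c..d} \<subseteq> {a..b}) \<Longrightarrow>
        pairwise (\<lambda>p q. {fst p<..<snd p} \<inter> {fst q<..<snd q} = {}) P \<Longrightarrow>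
        (\<Sum>(c, d) \<in> P. d - c) < \<delta> \<Longrightarrow> (\<Sum>(c, d) \<in> P. norm (f d - f c)) < e"
    using assms unfolding absolutely_continuous_fun_on_def by meson
  have "dist (f s) (f t) < e" if "s \<in> {a..b}" "dist s t < \<delta>" for s
    using ac[of "{(min s t, max s t)}"] that t
    by (cases "s \<le> t") (auto simp: dist_norm min_def max_def norm_minus_commute)
  with \<delta> show "\<exists>\<delta>>0. \<forall>s\<in>{a..b}. dist s t < \<delta> \<longrightarrow> dist (f s) (f t) < e"
    by blast
qed

lemma absolutely_continuous_fun_on_subset:
  assumes "absolutely_continuous_fun_on S f" "T \<subseteq> S"
  shows "absolutely_continuous_fun_on T f"
  unfolding absolutely_continuous_fun_on_def
proof (intro allI impI)
  fix e :: real assume "e > 0"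
  then obtain \<delta> where \<delta>: "\<delta> > 0" and ac: "\<And>P :: (real \<times> real) set. finite P \<Longrightarrow> (\<forall>(c, d) \<in> P. c \<le> d \<and> {c..d} \<subseteq> S) \<Longrightarrow>
        pairwise (\<lambda>p q. {fst p<..<snd p} \<inter> {fst q<..<snd q} = {}) P \<Longrightarrow>
        (\<Sum>(c, d) \<in> P. d - c) < \<delta> \<Longrightarrow> (\<Sum>(c, d) \<in> P. norm (f d - f c)) < e"
    using assms(1) unfolding absolutely_continuous_fun_on_def by meson
  show "\<exists>\<delta>>0. \<forall>P :: (real \<times> real) set. finite P \<and> (\<forall>(c, d) \<in> P. c \<le> d \<and> {c..d} \<subseteq> T) \<and>
        pairwise (\<lambda>p q. {fst p<..<snd p} \<inter> {fst q<..<snd q} = {}) P \<and>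
        (\<Sum>(c, d) \<in> P. d - c) < \<delta> \<longrightarrow> (\<Sum>(c, d) \<in> P. norm (f d - f c)) < e"
  proof (intro exI[of _ \<delta>] conjI allI impI \<delta>)
    fix P :: "(real \<times> real) set"
    assume P: "finite P \<and> (\<forall>(c, d) \<in> P. c \<le> d \<and> {c..d} \<subseteq> T) \<and>
        pairwise (\<lambda>p q. {fst p<..<snd p} \<inter> {fst q<..<snd q} = {}) P \<and> (\<Sum>(c, d) \<in> P. d - c) < \<delta>"
    then have "\<forall>(c, d) \<in> P. c \<le> d \<and> {c..d} \<subseteq> S"
      using assms(2) by fast
    with P show "(\<Sum>(c, d) \<in> P. norm (f d - f c)) < e"
      by (intro ac) blast+
  qed
qed

text \<open>The fundamental theorem of calculus for a curve that is differentiable almost everywhere, by a gauge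
  argument. Away from the exceptional null set \<open>N\<close> the gauge makes the difference quotient accurate, as in the
  classical theorem. At points of \<open>N\<close> it confines the intervals to an open superset of small measure;
  their total length is then small, and so is the total increment of \<open>f\<close> over them by absolute continuity.\<close>

theorem absolutely_continuous_has_integral:
  fixes f :: "real \<Rightarrow> 'a::euclidean_space"
  assumes AC: "absolutely_continuous_fun_on {a..b} f" and "a \<le> b"
    and deriv: "AE t in lebesgue_on {a..b}. (f has_vector_derivative f' t) (at t within {a..b})"
  shows "(f' has_integral (f b - f a)) {a..b}"
proof (cases "a = b")
  case True
  then show ?thesis by (simp add: has_integral_refl)
next
  case False
  with \<open>a \<le> b\<close> have "a < b" by simp
  have "AE t in lebesgue. t \<in> {a..b} \<longrightarrow> (f has_vector_derivative f' t) (at t within {a..b})"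
    using deriv by (simp add: AE_restrict_space_iff)
  then obtain N where N: "N \<in> null_sets lebesgue"
    and der: "\<And>t. t \<in> {a..b} \<Longrightarrow> t \<notin> N \<Longrightarrow> (f has_vector_derivative f' t) (at t within {a..b})"
    by (elim AE_E3) auto
  \<comment> \<open>With the value 0 on \<open>N\<close>, the Riemann sum has no contribution there.\<close>
  define g where "g t = (if t \<in> N then 0 else f' t)" for t
  have "(g has_integral (f b - f a)) {a..b}"
    unfolding has_integral_factor_content_real
  proof (intro allI impI)
    fix e :: real assume "e > 0"
    \<comment> \<open>The factor \<open>b - a\<close> turns the absolute error allowed on \<open>N\<close> into half of the
      error proportional to the length of the interval.\<close>
    define e' where "e' = e / 2 * (b - a)"
    have "e' > 0" using \<open>e > 0\<close> \<open>a < b\<close> by (simp add: e'_def)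
    then obtain \<delta> where \<delta>: "\<delta> > 0" and ac: "\<And>P :: (real \<times> real) set. finite P \<Longrightarrow> (\<forall>(c, d) \<in> P. c \<le> d \<and> {c..d} \<subseteq> {a..b}) \<Longrightarrow>
          pairwise (\<lambda>p q. {fst p<..<snd p} \<inter> {fst q<..<snd q} = {}) P \<Longrightarrow>
          (\<Sum>(c, d) \<in> P. d - c) < \<delta> \<Longrightarrow> (\<Sum>(c, d) \<in> P. norm (f d - f c)) < e'"
      using AC unfolding absolutely_continuous_fun_on_def by meson
    obtain U where U: "open U" "N \<subseteq> U" "U - N \<in> lmeasurable" "emeasure lebesgue (U - N) < ennreal \<delta>"
      using sets_lebesgue_outer_open[of N \<delta>] N \<delta> by auto
    have "emeasure lebesgue U \<le> emeasure lebesgue ((U - N) \<union> N)"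
      using U N by (intro emeasure_mono) auto
    also have "\<dots> = emeasure lebesgue (U - N)"
      by (rule emeasure_Un_null_set[OF fmeasurableD[OF U(3)] N])
    also note U(4)
    finally have U_small: "emeasure lborel U < ennreal \<delta>" using U(1) by simp
    have "\<exists>r>0. \<forall>s\<in>{a..b}. \<bar>s - t\<bar> < r \<longrightarrow> norm (f s - f t - (s - t) *\<^sub>R f' t) \<le> e / 2 * \<bar>s - t\<bar>"
      if "t \<in> {a..b} - N" for t
      using der[of t] that \<open>e > 0\<close>
      unfolding has_vector_derivative_def has_derivative_within_alt
      by (auto simp: dest!: spec[of _ "e / 2"])
    then obtain r where r: "\<And>t. t \<in> {a..b} - N \<Longrightarrow> r t > 0"
      and r': "\<And>t s. t \<in> {a..b} - N \<Longrightarrow> s \<in> {a..b} \<Longrightarrow> \<bar>s - t\<bar> < r t \<Longrightarrow>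
                norm (f s - f t - (s - t) *\<^sub>R f' t) \<le> e / 2 * \<bar>s - t\<bar>"
      by metis
    define \<gamma> where "\<gamma> t = (if t \<in> N then U else if t \<in> {a..b} then ball t (r t) else ball t 1)" for t
    have gauge: "gauge \<gamma>"
      using U(1,2) r by (auto simp: gauge_def \<gamma>_def)
    have sums: "norm ((\<Sum>(x, k)\<in>p. measure lborel k *\<^sub>R g x) - (f b - f a)) \<le> e * measure lborel {a..b}"
      if p: "p tagged_division_of {a..b}" and fine: "\<gamma> fine p" for p
    proof -
      note pD = tagged_division_ofD[OF p]
      have fin: "finite p" by (rule pD(1))
      have ivl: "\<exists>u v. u \<le> v \<and> k = {u..v} \<and> Inf k = u \<and> Sup k = v \<and> x \<in> {u..v} \<and> {u..v} \<subseteq> {a..b}"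
        if xk: "(x, k) \<in> p" for x k
      proof -
        obtain u v where k: "k = cbox u v" using pD(4)[OF xk] by blast
        moreover have "x \<in> k" by (rule pD(2)[OF xk])
        moreover have "k \<subseteq> {a..b}" by (rule pD(3)[OF xk])
        ultimately show ?thesis by auto
      qed
      define err where "err = (\<lambda>(x, k). measure lborel k *\<^sub>R g x - (f (Sup k) - f (Inf k)))"
      define pN where "pN = {(x, k) \<in> p. x \<in> N}"
      have pN: "pN \<subseteq> p" "finite pN" using fin by (auto simp: pN_def intro: finite_subset[of _ p])
      have "(\<Sum>(x, k)\<in>p. measure lborel k *\<^sub>R g x) - (f b - f a) = (\<Sum>z\<in>p. err z)"
        using additive_tagged_division_1[OF \<open>a \<le> b\<close> p, of f]
        by (simp add: err_def sum_subtractf case_prod_unfold)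
      also have "\<dots> = (\<Sum>z\<in>pN. err z) + (\<Sum>z\<in>p - pN. err z)"
        using sum.subset_diff[OF pN(1) fin, of err] by (simp add: add.commute)
      finally have split: "norm ((\<Sum>(x, k)\<in>p. measure lborel k *\<^sub>R g x) - (f b - f a))
          \<le> norm (\<Sum>z\<in>pN. err z) + norm (\<Sum>z\<in>p - pN. err z)"
        by (simp add: norm_triangle_ineq)
      have regular: "norm (err z) \<le> e / 2 * measure lborel (snd z)" if "z \<in> p - pN" for z
      proof -
        obtain x k where z: "z = (x, k)" by (cases z)
        with that have xk: "(x, k) \<in> p" "x \<notin> N" by (auto simp: pN_def)
        then obtain u v where k: "u \<le> v" "k = {u..v}" "Inf k = u" "Sup k = v" "x \<in> {u..v}" "{u..v} \<subseteq> {a..b}"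
          using ivl by blast
        have x: "x \<in> {a..b} - N" using k xk by auto
        have "k \<subseteq> \<gamma> x" using fine xk(1) by (rule fineD)
        then have sub: "{u..v} \<subseteq> ball x (r x)" using x k(2) by (simp add: \<gamma>_def)
        have uv: "u \<in> {u..v}" "v \<in> {u..v}" using k(1) by auto
        then have uv': "\<bar>u - x\<bar> < r x" "\<bar>v - x\<bar> < r x" "u \<in> {a..b}" "v \<in> {a..b}"
          using sub k(6) by (auto simp: dist_real_def subset_iff)
        have "err z = (f u - f x - (u - x) *\<^sub>R f' x) - (f v - f x - (v - x) *\<^sub>R f' x)"
          using k(1,3,4) xk(2) by (simp add: err_def z g_def k(2) algebra_simps)
        also have "norm \<dots> \<le> norm (f u - f x - (u - x) *\<^sub>R f' x) + norm (f v - f x - (v - x) *\<^sub>R f' x)"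
          by (rule norm_triangle_ineq4)
        also have "\<dots> \<le> e / 2 * \<bar>u - x\<bar> + e / 2 * \<bar>v - x\<bar>"
          using uv' by (intro add_mono r' x)
        also have "\<dots> = e / 2 * measure lborel (snd z)"
          using k(1,2,5) by (simp add: z flip: distrib_left)
        finally show ?thesis .
      qed
      have "norm (\<Sum>z\<in>p - pN. err z) \<le> (\<Sum>z\<in>p - pN. e / 2 * measure lborel (snd z))"
        using regular by (rule sum_norm_le)
      also have "\<dots> \<le> (\<Sum>z\<in>p. e / 2 * measure lborel (snd z))"
        using \<open>e > 0\<close> fin by (intro sum_mono2) auto
      also have "\<dots> = e / 2 * (\<Sum>z\<in>p. measure lborel (snd z))"
        by (rule sum_distrib_left[symmetric])
      also have "(\<Sum>z\<in>p. measure lborel (snd z)) = measure lborel {a..b}"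
        using additive_content_tagged_division[of p a b] p unfolding cbox_interval case_prod_unfold by blast
      finally have 1: "norm (\<Sum>z\<in>p - pN. err z) \<le> e / 2 * measure lborel {a..b}" .
      define h where "h = (\<lambda>z::real \<times> real set. (Inf (snd z), Sup (snd z)))"
      define P where "P = h ` pN"
      have finP: "finite P" using pN(2) by (simp add: P_def)
      have P_ivl: "\<forall>(c, d) \<in> P. c \<le> d \<and> {c..d} \<subseteq> {a..b}"
        using ivl by (fastforce simp: P_def h_def pN_def)
      have disj: "{fst (h z)<..<snd (h z)} \<inter> {fst (h w)<..<snd (h w)} = {}"
        if "z \<in> p" "w \<in> p" "z \<noteq> w" for z w
      proof -
        have "interior (snd z) \<inter> interior (snd w) = {}"
          using pD(5)[of "fst z" "snd z" "fst w" "snd w"] that by (auto simp: prod_eq_iff)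
        moreover have "interior (snd y) = {fst (h y)<..<snd (h y)}" if yp: "y \<in> p" for y
        proof -
          obtain u v where "snd y = {u..v}" "Inf (snd y) = u" "Sup (snd y) = v"
            using ivl[of "fst y" "snd y"] yp by auto
          then show ?thesis by (simp add: h_def)
        qed
        ultimately show ?thesis using that by simp
      qed
      have P_disj: "pairwise (\<lambda>p q. {fst p<..<snd p} \<inter> {fst q<..<snd q} = {}) P"
      proof (intro pairwiseI)
        fix q q' assume "q \<in> P" "q' \<in> P" "q \<noteq> q'"
        then obtain z w where "q = h z" "q' = h w" "z \<in> pN" "w \<in> pN"
          by (auto simp: P_def)
        with \<open>q \<noteq> q'\<close> pN(1) disj[of z w] show "{fst q<..<snd q} \<inter> {fst q'<..<snd q'} = {}"
          by blast
      qed
      have "(\<Sum>(c, d) \<in> P. d - c) = (\<Sum>q\<in>P. measure lborel {fst q<..<snd q})"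
        using P_ivl by (intro sum.cong) auto
      also have "\<dots> = measure lborel (\<Union>q\<in>P. {fst q<..<snd q})"
      proof (rule measure_finite_Union[symmetric])
        show "disjoint_family_on (\<lambda>q. {fst q<..<snd q}) P"
          using P_disj unfolding disjoint_family_on_def pairwise_def by blast
        show "emeasure lborel {fst q<..<snd q} \<noteq> \<infinity>" if qP: "q \<in> P" for q
          using P_ivl qP by (auto simp: case_prod_unfold)
      qed (use finP in auto)
      also have "\<dots> < \<delta>"
      proof -
        have "{fst q<..<snd q} \<subseteq> U" if qP: "q \<in> P" for q
        proof -
          obtain x k where q: "q = h (x, k)" "(x, k) \<in> p" "x \<in> N"
            using qP by (auto simp: P_def pN_def)
          have "k \<subseteq> \<gamma> x" using fine q(2) by (rule fineD)
          with q(3) have "k \<subseteq> U" by (simp add: \<gamma>_def)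
          moreover obtain u v where "k = {u..v}" "Inf k = u" "Sup k = v"
            using ivl[OF q(2)] by blast
          then have "{fst q<..<snd q} \<subseteq> k"
            unfolding q(1) h_def by auto
          ultimately show ?thesis by blast
        qed
        then have "emeasure lborel (\<Union>q\<in>P. {fst q<..<snd q}) \<le> emeasure lborel U"
          using U(1) by (intro emeasure_mono) auto
        with U_small have "emeasure lborel (\<Union>q\<in>P. {fst q<..<snd q}) < ennreal \<delta>" by simp
        moreover from this have "emeasure lborel (\<Union>q\<in>P. {fst q<..<snd q}) \<noteq> top"
          by auto
        ultimately have "ennreal (measure lborel (\<Union>q\<in>P. {fst q<..<snd q})) < ennreal \<delta>"
          by (metis emeasure_eq_ennreal_measure)
        then show ?thesis
          by (simp only: ennreal_less_iff[OF measure_nonneg])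
      qed
      finally have "(\<Sum>(c, d) \<in> P. norm (f d - f c)) < e'"
        using ac[OF finP P_ivl P_disj] by blast
      also have "(\<Sum>(c, d) \<in> P. norm (f d - f c)) = (\<Sum>z\<in>pN. norm (f (snd (h z)) - f (fst (h z))))"
      proof -
        \<comment> \<open>Different tagged intervals give the same pair of endpoints only if they are degenerate.\<close>
        have "norm (f (snd (h z)) - f (fst (h z))) = 0" if "z \<in> pN" "w \<in> pN" "z \<noteq> w" "h z = h w" for z w
        proof -
          have "{fst (h z)<..<snd (h z)} = {}"
            using disj[of z w] that pN(1) by auto
          moreover have "fst (h z) \<le> snd (h z)"
            using P_ivl that(1) by (auto simp: P_def)
          ultimately have "fst (h z) = snd (h z)" by simp
          then show ?thesis by simp
        qed
        then show ?thesis
          unfolding P_def using pN(2) 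
          by (subst sum.reindex_nontrivial) (auto simp: case_prod_unfold o_def)
      qed
      finally have "(\<Sum>z\<in>pN. norm (f (snd (h z)) - f (fst (h z)))) < e'" .
      moreover have "norm (\<Sum>z\<in>pN. err z) \<le> (\<Sum>z\<in>pN. norm (f (snd (h z)) - f (fst (h z))))"
        by (intro sum_norm_le) (auto simp: err_def pN_def g_def h_def norm_minus_commute)
      ultimately have "norm (\<Sum>z\<in>pN. err z) \<le> e / 2 * measure lborel {a..b}"
        using \<open>a < b\<close> by (simp add: e'_def)
      with split 1 show ?thesis by simp
    qed
    show "\<exists>\<gamma>. gauge \<gamma> \<and> (\<forall>p. p tagged_division_of {a..b} \<and> \<gamma> fine p \<longrightarrow>
        norm ((\<Sum>(x, k)\<in>p. measure lborel k *\<^sub>R g x) - (f b - f a)) \<le> e * measure lborel {a..b})"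
      by (intro exI[of _ \<gamma>] conjI allI impI gauge sums) simp_all
  qed
  then show ?thesis
    by (rule has_integral_spike[of N, rotated 2]) (use N in \<open>auto simp: g_def negligible_iff_null_sets\<close>)
qed

lemma has_integral_norm_le_LINT:
  fixes f :: "real \<Rightarrow> 'b::euclidean_space"
  assumes "(f has_integral y) {c..d}" "f \<in> Linf {c..d}"
  shows "norm y \<le> (LINT t|lebesgue_on {c..d}. norm (f t))"
proof -
  have "integrable (lebesgue_on {c..d}) f"
    using assms(2) by (rule Linf_integrable) simp_all
  then have "(LINT t|lebesgue_on {c..d}. f t) = y"
    using assms(1) by (simp add: lebesgue_integral_eq_integral integral_unique)
  then show ?thesis
    using integral_norm_bound[of "lebesgue_on {c..d}" f] by simp
qed

section \<open>Volterra operators and the Neumann series\<close>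

text \<open>The source of all convergence below: every integration raises the power of \<open>t - c\<close> by one and
  contributes one factor to the factorial.\<close>

lemma iterated_integral_bound:
  fixes v :: "nat \<Rightarrow> real \<Rightarrow> real"
  assumes meas: "\<And>k. v k \<in> borel_measurable (lebesgue_on {c..d})"
    and nonneg: "\<And>k t. 0 \<le> v k t" and "M \<ge> 0" and base: "AE t in lebesgue_on {c..d}. v 0 t \<le> B"
    and step: "\<And>k. AE t in lebesgue_on {c..d}. v (Suc k) t \<le> M * (LINT \<tau>|lebesgue_on {c..t}. v k \<tau>)"
  shows "AE t in lebesgue_on {c..d}. v k t \<le> B * (M * (t - c)) ^ k / fact k"
proof (induction k)
  case 0
  then show ?case using base by simp
next
  case (Suc k)
  define p where "p \<tau> = B * (M * (\<tau> - c)) ^ k / fact k" for \<tau>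
  have p_int: "integrable (lebesgue_on {c..t}) p" for t
    unfolding p_def by (intro continuous_imp_integrable_real continuous_intros) auto
  have p_val: "(LINT \<tau>|lebesgue_on {c..t}. p \<tau>) = B * M ^ k * (t - c) ^ Suc k / fact (Suc k)" if "c \<le> t" for t
  proof -
    have "(LINT \<tau>|lebesgue_on {c..t}. p \<tau>) = (LINT \<tau>|lebesgue_on {c..t}. (B * M ^ k / fact k) * (\<tau> - c) ^ k)"
      by (simp add: p_def power_mult_distrib)
    also have "\<dots> = (B * M ^ k / fact k) * (LINT \<tau>|lebesgue_on {c..t}. (\<tau> - c) ^ k)"
      by (rule integral_mult_right_zero)
    also have "\<dots> = B * M ^ k * (t - c) ^ Suc k / fact (Suc k)"
      unfolding LINT_interval_power[OF that] by (simp add: field_simps)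
    finally show ?thesis .
  qed
  have "continuous_on {c..d} p"
    unfolding p_def by (intro continuous_intros) auto
  then have "bounded (p ` {c..d})"
    by (intro compact_imp_bounded compact_continuous_image) auto
  then obtain C where "\<forall>y\<in>p ` {c..d}. norm y \<le> C"
    by (auto simp only: bounded_iff)
  then have C: "\<bar>p t\<bar> \<le> C" if "t \<in> {c..d}" for t
    using that by auto
  have bnd: "AE t in lebesgue_on {c..d}. norm (v k t) \<le> C"
    using Suc AE_space
  proof eventually_elim
    case (elim t)
    then have "v k t \<le> p t" "t \<in> {c..d}" by (simp_all add: p_def)
    with C[of t] nonneg[of k t] show ?case by simp
  qed
  show ?case
    using step[of k] AE_space
  proof eventually_elim
    case (elim t)
    then have t: "c \<le> t" "t \<le> d" by auto
    have "(LINT \<tau>|lebesgue_on {c..t}. v k \<tau>) \<le> (LINT \<tau>|lebesgue_on {c..t}. p \<tau>)"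
      using Suc t unfolding p_def[symmetric]
      by (intro Bochner_Integration.integral_mono_AE p_int integrable_interval[OF meas bnd]) (auto elim: AE_interval_subset)
    then have "M * (LINT \<tau>|lebesgue_on {c..t}. v k \<tau>) \<le> M * (B * M ^ k * (t - c) ^ Suc k / fact (Suc k))"
      using \<open>M \<ge> 0\<close> p_val[OF t(1)] by (intro mult_left_mono) auto
    also have "\<dots> = B * (M * (t - c)) ^ Suc k / fact (Suc k)"
      by (simp add: power_mult_distrib)
    finally show ?case using elim(1) by linarith
  qed
qed

lemma power_over_fact_tendsto_0: "(\<lambda>k. B * x ^ k / fact k) \<longlonglongrightarrow> (0::real)"
proof -
  have "(\<lambda>k. inverse (fact k) * x ^ k) \<longlonglongrightarrow> 0"
    by (rule summable_LIMSEQ_zero[OF summable_exp])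
  from tendsto_mult_left[OF this, of B] show ?thesis
    by (simp add: field_simps)
qed

text \<open>A form of Gronwall's inequality: the constant sequence \<open>v, v, v, \<dots>\<close> satisfies the hypotheses of
  \<open>iterated_integral_bound\<close>, so \<open>v\<close> lies below every term of a null sequence.\<close>

lemma integral_inequality_imp_AE_zero:
  fixes v :: "real \<Rightarrow> real"
  assumes meas: "v \<in> borel_measurable (lebesgue_on {c..d})"
    and nonneg: "\<And>t. 0 \<le> v t" and "M \<ge> 0" and base: "AE t in lebesgue_on {c..d}. v t \<le> B"
    and step: "AE t in lebesgue_on {c..d}. v t \<le> M * (LINT \<tau>|lebesgue_on {c..t}. v \<tau>)"
  shows "AE t in lebesgue_on {c..d}. v t = 0"
proof -
  have "AE t in lebesgue_on {c..d}. \<forall>k. v t \<le> B * (M * (t - c)) ^ k / fact k"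
    unfolding AE_all_countable using iterated_integral_bound[of "\<lambda>_. v", OF meas nonneg \<open>M \<ge> 0\<close> base step] by blast
  then show ?thesis
  proof (rule eventually_mono)
    fix t assume "\<forall>k. v t \<le> B * (M * (t - c)) ^ k / fact k"
    then have "v t \<le> 0"
      by (intro LIMSEQ_le_const[OF power_over_fact_tendsto_0]) auto
    with nonneg[of t] show "v t = 0" by simp
  qed
qed

text \<open>Only the linearity and the pointwise bound by an integral over the past matter for the Neumann series,
  not the kernel. The laws hold for almost every \<open>t\<close>, because for exceptional \<open>t\<close> the kernel need not be
  integrable and the operator then takes a default value.\<close>

locale Volterra_operator =
  fixes c d M :: real and K :: "(real \<Rightarrow> 'b::euclidean_space) \<Rightarrow> real \<Rightarrow> 'b"
  assumes M_nonneg: "0 \<le> M"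
    and K_measurable: "f \<in> Linf {c..d} \<Longrightarrow> K f \<in> borel_measurable (lebesgue_on {c..d})"
    and K_add: "f \<in> Linf {c..d} \<Longrightarrow> g \<in> Linf {c..d} \<Longrightarrow>
      AE t in lebesgue_on {c..d}. K (\<lambda>\<tau>. f \<tau> + g \<tau>) t = K f t + K g t"
    and K_scaleR: "f \<in> Linf {c..d} \<Longrightarrow> AE t in lebesgue_on {c..d}. K (\<lambda>\<tau>. r *\<^sub>R f \<tau>) t = r *\<^sub>R K f t"
    and K_bound: "f \<in> Linf {c..d} \<Longrightarrow>
      AE t in lebesgue_on {c..d}. norm (K f t) \<le> M * (LINT \<tau>|lebesgue_on {c..t}. norm (f \<tau>))"
begin

lemma K_norm_bound:
  assumes f: "f \<in> Linf {c..d}" and C: "AE t in lebesgue_on {c..d}. norm (f t) \<le> C" "0 \<le> C"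
  shows "AE t in lebesgue_on {c..d}. norm (K f t) \<le> M * \<bar>d - c\<bar> * C"
  using K_bound[OF f] AE_space
proof eventually_elim
  case (elim t)
  then have t: "t \<in> {c..d}" by simp
  have "(LINT \<tau>|lebesgue_on {c..t}. norm (f \<tau>)) \<le> C * (t - c)"
    by (rule LINT_norm_le[OF Linf_measurable[OF f] C(1) t])
  also have "\<dots> \<le> C * \<bar>d - c\<bar>"
    using C(2) t by (intro mult_left_mono) auto
  finally have "M * (LINT \<tau>|lebesgue_on {c..t}. norm (f \<tau>)) \<le> M * (C * \<bar>d - c\<bar>)"
    using M_nonneg by (rule mult_left_mono)
  with elim(1) show ?case by (simp add: ac_simps)
qed

lemma K_Linf:
  assumes f: "f \<in> Linf {c..d}"
  shows "K f \<in> Linf {c..d}"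
proof -
  from f obtain C where "AE x in lebesgue_on {c..d}. norm (f x) \<le> C" "0 \<le> C" by (rule LinfE)
  from LinfI[OF K_measurable[OF f] K_norm_bound[OF f this]] show ?thesis .
qed

lemma K_Linf_norm:
  assumes f: "f \<in> Linf {c..d}"
  shows "Linf_norm {c..d} (K f) \<le> ennreal (M * \<bar>d - c\<bar>) * Linf_norm {c..d} f"
proof -
  from f obtain C where C: "AE x in lebesgue_on {c..d}. norm (f x) \<le> C" "0 \<le> C" "Linf_norm {c..d} f = ennreal C"
    by (rule LinfE)
  have "Linf_norm {c..d} (K f) \<le> ennreal (M * \<bar>d - c\<bar> * C)"
    by (rule Linf_norm_le[OF K_measurable[OF f] K_norm_bound[OF f C(1,2)]])
  also have "\<dots> = ennreal (M * \<bar>d - c\<bar>) * Linf_norm {c..d} f"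
    using C(2,3) M_nonneg by (simp add: ennreal_mult)
  finally show ?thesis .
qed

lemma bounded_linear_K: "bounded_linear_Linf {c<..<d} K"
  unfolding bounded_linear_Linf_def Linf_open_interval AE_open_interval_iff
  using K_Linf K_add K_scaleR K_Linf_norm
  by (auto simp: Linf_norm_open_interval Linf_measurable intro!: exI[of _ "M * \<bar>d - c\<bar>"])

text \<open>The operator acts on functions, not on classes of functions. That it respects equality almost
  everywhere follows from its bound, applied to the difference.\<close>

lemma K_cong_AE:
  assumes f: "f \<in> Linf {c..d}" and h: "h \<in> Linf {c..d}" and eq: "AE t in lebesgue_on {c..d}. f t = h t"
  shows "AE t in lebesgue_on {c..d}. K f t = K h t"
proof -
  have diff: "(\<lambda>t. f t - h t) \<in> Linf {c..d}" using f h by (rule Linf_diff)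
  have z: "AE t in lebesgue_on {c..d}. norm (f t - h t) \<le> 0"
    using eq by eventually_elim simp
  have "AE t in lebesgue_on {c..d}. norm (K (\<lambda>t. f t - h t) t) \<le> 0"
    using K_norm_bound[OF diff z] by simp
  with K_add[OF h diff] show ?thesis by eventually_elim simp
qed

lemma K_power_Linf: "f \<in> Linf {c..d} \<Longrightarrow> (K ^^ k) f \<in> Linf {c..d}"
  by (induction k) (auto intro: K_Linf)

lemma K_power_bound:
  assumes f: "f \<in> Linf {c..d}" and C: "AE t in lebesgue_on {c..d}. norm (f t) \<le> C"
  shows "AE t in lebesgue_on {c..d}. norm ((K ^^ k) f t) \<le> C * (M * (t - c)) ^ k / fact k"
proof (rule iterated_integral_bound[where v = "\<lambda>k t. norm ((K ^^ k) f t)"])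
  show "(\<lambda>t. norm ((K ^^ k) f t)) \<in> borel_measurable (lebesgue_on {c..d})" for k
    by (rule measurable_compose[OF Linf_measurable[OF K_power_Linf[OF f]] borel_measurable_norm])
  show "AE t in lebesgue_on {c..d}. norm ((K ^^ Suc k) f t)
      \<le> M * (LINT \<tau>|lebesgue_on {c..t}. norm ((K ^^ k) f \<tau>))" for k
    using K_bound[OF K_power_Linf[OF f]] by simp
qed (use C M_nonneg in auto)

text \<open>Substituting \<open>f = g + K f\<close> into itself \<open>k\<close> times.\<close>

lemma fixed_point_remainder:
  assumes f: "f \<in> Linf {c..d}" and g: "g \<in> Linf {c..d}"
    and fp: "AE t in lebesgue_on {c..d}. f t = g t + K f t"
  shows "AE t in lebesgue_on {c..d}. f t - (\<Sum>i<k. (K ^^ i) g t) = (K ^^ k) f t"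
proof -
  have step: "AE t in lebesgue_on {c..d}. (K ^^ k) f t = (K ^^ k) g t + (K ^^ Suc k) f t" for k
  proof (induction k)
    case 0
    then show ?case using fp by simp
  next
    case (Suc k)
    have "AE t in lebesgue_on {c..d}. K ((K ^^ k) f) t = K (\<lambda>\<tau>. (K ^^ k) g \<tau> + (K ^^ Suc k) f \<tau>) t"
      using Suc by (intro K_cong_AE Linf_add K_power_Linf f g)
    moreover have "AE t in lebesgue_on {c..d}. K (\<lambda>\<tau>. (K ^^ k) g \<tau> + (K ^^ Suc k) f \<tau>) t =
        K ((K ^^ k) g) t + K ((K ^^ Suc k) f) t"
      by (intro K_add K_power_Linf f g)
    ultimately show ?case by eventually_elim simp
  qed
  show ?thesis
  proof (induction k)
    case 0
    then show ?case by simp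
  next
    case (Suc k)
    from Suc step[of k] show ?case
      by eventually_elim (simp add: algebra_simps)
  qed
qed

text \<open>The remainder after \<open>k\<close> terms is \<open>K\<^sup>k f\<close>, and \<open>K_power_bound\<close> drives it to zero uniformly. Since
  countably many terms share one null set, the series also converges pointwise almost everywhere.\<close>

lemma Neumann_series:
  assumes f: "f \<in> Linf {c..d}" and g: "g \<in> Linf {c..d}"
    and fp: "AE t in lebesgue_on {c..d}. f t = g t + K f t"
  shows "(\<lambda>k. Linf_norm {c<..<d} (\<lambda>t. f t - (\<Sum>i<k. (K ^^ i) g t))) \<longlonglongrightarrow> 0"
    and "AE t in lebesgue_on {c..d}. f t = (\<Sum>i. (K ^^ i) g t)"
proof -
  from f obtain C where C: "AE x in lebesgue_on {c..d}. norm (f x) \<le> C" "0 \<le> C"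
    by (rule LinfE)
  have bnd: "AE t in lebesgue_on {c..d}. norm (f t - (\<Sum>i<k. (K ^^ i) g t)) \<le> C * (M * (t - c)) ^ k / fact k" for k
    using fixed_point_remainder[OF f g fp, of k] K_power_bound[OF f C(1), of k]
    by eventually_elim simp
  have meas: "(\<lambda>t. f t - (\<Sum>i<k. (K ^^ i) g t)) \<in> borel_measurable (lebesgue_on {c..d})" for k
    using K_power_Linf[OF g] f by (intro borel_measurable_diff borel_measurable_sum Linf_measurable)
  have le: "Linf_norm {c<..<d} (\<lambda>t. f t - (\<Sum>i<k. (K ^^ i) g t)) \<le> ennreal (C * (M * \<bar>d - c\<bar>) ^ k / fact k)" for k
    unfolding Linf_norm_open_interval[OF meas]
  proof (rule Linf_norm_le[OF meas])
    show "AE t in lebesgue_on {c..d}. norm (f t - (\<Sum>i<k. (K ^^ i) g t)) \<le> C * (M * \<bar>d - c\<bar>) ^ k / fact k"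
      using bnd[of k] AE_space
    proof eventually_elim
      case (elim t)
      have "C * (M * (t - c)) ^ k / fact k \<le> C * (M * \<bar>d - c\<bar>) ^ k / fact k"
        using elim(2) C(2) M_nonneg by (intro divide_right_mono mult_left_mono power_mono) auto
      with elim(1) show ?case by linarith
    qed
  qed
  have "(\<lambda>k. ennreal (C * (M * \<bar>d - c\<bar>) ^ k / fact k)) \<longlonglongrightarrow> ennreal 0"
    by (intro tendsto_ennrealI power_over_fact_tendsto_0)
  then have lim: "(\<lambda>k. ennreal (C * (M * \<bar>d - c\<bar>) ^ k / fact k)) \<longlonglongrightarrow> 0" by simp
  show "(\<lambda>k. Linf_norm {c<..<d} (\<lambda>t. f t - (\<Sum>i<k. (K ^^ i) g t))) \<longlonglongrightarrow> 0"
    by (rule tendsto_sandwich[OF _ _ tendsto_const lim]) (use le in auto)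
  have "AE t in lebesgue_on {c..d}. \<forall>k. norm (f t - (\<Sum>i<k. (K ^^ i) g t)) \<le> C * (M * (t - c)) ^ k / fact k"
    unfolding AE_all_countable using bnd by blast
  then show "AE t in lebesgue_on {c..d}. f t = (\<Sum>i. (K ^^ i) g t)"
  proof eventually_elim
    case (elim t)
    have "(\<lambda>k. f t - (\<Sum>i<k. (K ^^ i) g t)) \<longlonglongrightarrow> 0"
      by (rule Lim_null_comparison[OF _ power_over_fact_tendsto_0[of C "M * (t - c)"]]) (use elim in auto)
    from tendsto_diff[OF tendsto_const[of "f t"] this] have "(\<lambda>i. (K ^^ i) g t) sums f t"
      by (simp add: sums_def)
    then show ?case by (rule sums_unique)
  qed
qed

end

section \<open>Filippov sets\<close>

lemma Filippov_subset_cball: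
  fixes h :: "real \<Rightarrow> 'a::euclidean_space \<Rightarrow> 'b::euclidean_space"
  assumes "AE y in lebesgue. y \<in> ball x \<delta> \<longrightarrow> norm (h t y) \<le> C" "\<delta> > 0"
  shows "Filippov h t x \<subseteq> cball 0 C"
proof -
  obtain M where M: "M \<in> null_sets lebesgue" "\<And>y. y \<notin> M \<Longrightarrow> y \<in> ball x \<delta> \<Longrightarrow> norm (h t y) \<le> C"
    using assms(1) by (elim AE_E3) auto
  have "closure (convex hull (h t ` (ball x \<delta> - M))) \<subseteq> cball 0 C"
    using M(2) by (intro closure_minimal hull_minimal) auto
  then show ?thesis
    using M(1) assms(2) unfolding Filippov_def by blast
qed

lemma Filippov_subset_singleton:
  fixes h :: "real \<Rightarrow> 'a::euclidean_space \<Rightarrow> 'b::euclidean_space"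
  assumes "open G" "x \<in> G" "continuous_on G (h t)"
  shows "Filippov h t x \<subseteq> {h t x}"
proof
  fix v assume v: "v \<in> Filippov h t x"
  have "dist (h t x) v \<le> e" if e: "e > 0" for e
  proof -
    obtain \<delta>1 where \<delta>1: "\<delta>1 > 0" "ball x \<delta>1 \<subseteq> G"
      using openE[OF assms(1,2)] .
    obtain \<delta>2 where \<delta>2: "\<delta>2 > 0" "\<And>y. y \<in> G \<Longrightarrow> dist y x < \<delta>2 \<Longrightarrow> dist (h t y) (h t x) < e"
      using assms(2,3) e unfolding continuous_on_iff by meson
    define \<delta> where "\<delta> = min \<delta>1 \<delta>2"
    have "\<delta> > 0" using \<delta>1 \<delta>2 by (simp add: \<delta>_def)
    have "h t y \<in> cball (h t x) e" if "y \<in> ball x \<delta>" for y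
    proof -
      have "y \<in> G" "dist y x < \<delta>2" using that \<delta>1(2) by (auto simp: \<delta>_def dist_commute)
      from \<delta>2(2)[OF this] show ?thesis by (simp add: dist_commute)
    qed
    then have "closure (convex hull (h t ` (ball x \<delta> - {}))) \<subseteq> cball (h t x) e"
      by (intro closure_minimal hull_minimal) auto
    moreover have "v \<in> closure (convex hull (h t ` (ball x \<delta> - {})))"
      using v \<open>\<delta> > 0\<close> unfolding Filippov_def by blast
    ultimately show ?thesis by auto
  qed
  then have "dist (h t x) v \<le> 0"
    by (rule field_le_epsilon[of _ 0, simplified])
  then show "v \<in> {h t x}" by simp
qed

text \<open>What is used of the two kinds of solutions holds for both sets of admissible controls, so
  they are treated together.\<close>

definition Utkin_set :: "(real \<Rightarrow> 'a::euclidean_space \<Rightarrow> real^'m) \<Rightarrow> real \<Rightarrow> 'a \<Rightarrow> (real^'m) set" where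
  "Utkin_set u t x = Filippov u t x \<union> Filippov_componentwise u t x"

text \<open>In the componentwise case each of the components is bounded by \<open>C\<close>, which costs a factor of the
  dimension.\<close>

lemma Utkin_set_bounded:
  fixes u :: "real \<Rightarrow> 'a::euclidean_space \<Rightarrow> real^'m"
  assumes bnd: "AE y in lebesgue. y \<in> ball x \<delta> \<longrightarrow> norm (u t y) \<le> C" "\<delta> > 0" "C \<ge> 0"
    and v: "v \<in> Utkin_set u t x"
  shows "norm v \<le> real CARD('m) * C"
  using v unfolding Utkin_set_def
proof
  assume "v \<in> Filippov u t x"
  then have "v \<in> cball 0 C"
    by (rule subsetD[OF Filippov_subset_cball[of x \<delta> u t C, OF bnd(1,2)]])
  then have "norm v \<le> 1 * C"
    by simp
  also have "\<dots> \<le> real CARD('m) * C"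
    using \<open>C \<ge> 0\<close> by (intro mult_right_mono) (auto simp: Suc_le_eq)
  finally show ?thesis .
next
  assume v: "v \<in> Filippov_componentwise u t x"
  have "\<bar>v $ i\<bar> \<le> C" for i
  proof -
    have "AE y in lebesgue. y \<in> ball x \<delta> \<longrightarrow> norm (u t y $ i) \<le> C"
      using bnd(1) by (rule eventually_mono) (auto intro: order_trans[OF component_le_norm_cart])
    from Filippov_subset_cball[of x \<delta> "\<lambda>t x. u t x $ i" t C, OF this bnd(2)]
    have "Filippov (\<lambda>t x. u t x $ i) t x \<subseteq> cball 0 C" .
    moreover have "v $ i \<in> Filippov (\<lambda>t x. u t x $ i) t x"
      using v unfolding Filippov_componentwise_def by blast
    ultimately show ?thesis by auto
  qed
  then have "(\<Sum>i\<in>UNIV. \<bar>v $ i\<bar>) \<le> of_nat CARD('m) * C"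
    by (intro sum_bounded_above)
  with norm_le_l1_cart[of v] show ?thesis by simp
qed

lemma Utkin_set_subset_singleton:
  fixes u :: "real \<Rightarrow> 'a::euclidean_space \<Rightarrow> real^'m"
  assumes "open G" "x \<in> G" "continuous_on G (u t)"
  shows "Utkin_set u t x \<subseteq> {u t x}"
proof -
  have "Filippov u t x \<subseteq> {u t x}"
    using assms by (rule Filippov_subset_singleton)
  moreover have "Filippov_componentwise u t x \<subseteq> {u t x}"
  proof
    fix v assume v: "v \<in> Filippov_componentwise u t x"
    have "v $ i = u t x $ i" for i
    proof -
      have "Filippov (\<lambda>t x. u t x $ i) t x \<subseteq> {u t x $ i}"
        using assms by (intro Filippov_subset_singleton[where G = G]) (auto intro: continuous_on_component)
      moreover have "v $ i \<in> Filippov (\<lambda>t x. u t x $ i) t x"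
        using v unfolding Filippov_componentwise_def by blast
      ultimately show ?thesis by blast
    qed
    then show "v \<in> {u t x}" by (simp add: vec_eq_iff)
  qed
  ultimately show ?thesis by (simp add: Utkin_set_def)
qed

lemma locally_Lipschitz_tx_continuous:
  fixes h :: "real \<Rightarrow> 'a::euclidean_space \<Rightarrow> 'b::euclidean_space"
  assumes "locally_Lipschitz_tx h"
  shows "continuous_on UNIV (h t)"
proof -
  have "isCont (h t) x" for x
  proof -
    obtain l where l: "\<And>y z. y \<in> cball x 1 \<Longrightarrow> z \<in> cball x 1 \<Longrightarrow> norm (h t y - h t z) \<le> l t * norm (y - z)"
      using assms unfolding locally_Lipschitz_tx_def by (meson compact_cball)
    have "eventually (\<lambda>y. y \<in> ball x 1) (nhds x)"
      by (intro eventually_nhds_in_open) auto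
    then have "eventually (\<lambda>y. norm (h t y - h t x) \<le> l t * norm (y - x)) (at x)"
      unfolding eventually_at_filter by (rule eventually_mono) (auto intro!: l)
    moreover have "((\<lambda>y. l t * norm (y - x)) \<longlongrightarrow> l t * norm (x - x)) (at x)"
      by (intro tendsto_intros)
    then have "((\<lambda>y. l t * norm (y - x)) \<longlongrightarrow> 0) (at x)" by simp
    ultimately have "((\<lambda>y. h t y - h t x) \<longlongrightarrow> 0) (at x)"
      by (rule Lim_null_comparison)
    then show ?thesis
      unfolding isCont_def by (rule Lim_null[THEN iffD2])
  qed
  then show ?thesis by (simp add: continuous_on_eq_continuous_at)
qed

text \<open>A point outside the union of the boundaries lies in an open piece, and there \<open>u t\<close> agrees with
  a continuous function. Since there are finitely many pieces, one null set of times serves all points.\<close>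

lemma piecewise_Lipschitz_tx_Utkin_set:
  fixes u :: "real \<Rightarrow> 'a::euclidean_space \<Rightarrow> real^'m"
  assumes "piecewise_Lipschitz_tx u D"
  shows "AE t in lebesgue. \<forall>x. x \<notin> D \<longrightarrow> Utkin_set u t x \<subseteq> {u t x}"
proof -
  obtain N :: nat and G where G: "\<forall>j \<in> {1..N}. open (G j) \<and> connected (G j) \<and> interior (G j) \<noteq> {} \<and>
                      continuous_boundary (G j)"
    and cover: "(\<Union>j \<in> {1..N}. closure (G j)) = UNIV"
    and D: "D = (\<Union>j \<in> {1..N}. frontier (G j))"
    and pieces: "\<forall>j \<in> {1..N}. \<exists>hj. locally_Lipschitz_tx hj \<and> (AE t in lebesgue. \<forall>x \<in> G j. hj t x = u t x)"
    using assms unfolding piecewise_Lipschitz_tx_def by (elim conjE exE) (rule that)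
  have "AE t in lebesgue. \<forall>j\<in>{1..N}. continuous_on (G j) (u t)"
  proof (rule AE_finite_allI)
    fix j assume "j \<in> {1..N}"
    then obtain hj where hj: "locally_Lipschitz_tx hj" "AE t in lebesgue. \<forall>x \<in> G j. hj t x = u t x"
      using pieces by blast
    from hj(2) show "AE t in lebesgue. continuous_on (G j) (u t)"
    proof (rule eventually_mono)
      fix t assume "\<forall>x \<in> G j. hj t x = u t x"
      then show "continuous_on (G j) (u t)"
        using continuous_on_subset[OF locally_Lipschitz_tx_continuous[OF hj(1)], of "G j" t]
        by (simp cong: continuous_on_cong)
    qed
  qed simp
  then show ?thesis
  proof (rule eventually_mono, intro allI impI)
    fix t x assume cont: "\<forall>j\<in>{1..N}. continuous_on (G j) (u t)" and x: "x \<notin> D"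
    obtain j where j: "j \<in> {1..N}" "x \<in> closure (G j)"
      using cover by blast
    with x D have "x \<in> G j"
      using interior_subset unfolding frontier_def by blast
    with j cont G show "Utkin_set u t x \<subseteq> {u t x}"
      by (intro Utkin_set_subset_singleton[of "G j"]) auto
  qed
qed

section \<open>The controlled system and its memory term\<close>

locale controlled_system =
  fixes \<Phi> :: "real \<Rightarrow> real \<Rightarrow> real^'n^'n"
    and a a' :: "real \<Rightarrow> real^'n \<Rightarrow> real^'n"
    and b b' :: "real \<Rightarrow> real^'n \<Rightarrow> real^'m^'n"
    and u :: "real \<Rightarrow> real^'n \<Rightarrow> real^'m"
    and s :: "real^'n \<Rightarrow> real^'m"
  assumes \<Phi>_measurable: "(\<lambda>(t, \<tau>). \<Phi> t \<tau>) \<in> borel_measurable (lebesgue_on {(t, \<tau>). t \<ge> \<tau>})"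
    and \<Phi>_bounded: "locally_ess_bounded_on {(t, \<tau>). t \<ge> \<tau>} (\<lambda>(t, \<tau>). \<Phi> t \<tau>)"
    and a: "measurable_tx a" "locally_ess_bounded_tx a" "\<forall>t. continuous_on UNIV (a t)"
    and a': "measurable_tx a'" "locally_ess_bounded_tx a'" "\<forall>t. continuous_on UNIV (a' t)"
    and b: "measurable_tx b" "locally_ess_bounded_tx b" "\<forall>t. continuous_on UNIV (b t)"
    and b': "measurable_tx b'" "locally_ess_bounded_tx b'" "\<forall>t. continuous_on UNIV (b' t)"
    and u_bounded: "locally_ess_bounded_tx u"
    and s_C1: "C1_map s"
    and u_piecewise: "piecewise_Lipschitz_tx u {x. s x = 0}"
    and G_invertible: "AE t in lebesgue. \<forall>x. invertible (G_matrix s b t x)"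
    and G_inv_bounded: "locally_ess_bounded_tx (\<lambda>t x. matrix_inv (G_matrix s b t x))"
begin

abbreviation D where "D y \<equiv> jacobian s (at y)"

abbreviation G_inv where "G_inv t y \<equiv> matrix_inv (G_matrix s b t y)"

text \<open>The memory term of the equation as an operator on the forcing \<open>q\<close>.\<close>

definition history :: "real \<Rightarrow> (real \<Rightarrow> real^'n) \<Rightarrow> real \<Rightarrow> real^'n" where
  "history c q t = (LINT \<tau>|lebesgue_on {c..t}. \<Phi> t \<tau> *v q \<tau>)"

lemma s_derivative: "(s has_derivative (\<lambda>h. D y *v h)) (at y)"
  using s_C1 jacobian_works[of s "at y"] by (simp add: C1_map_def differentiable_on_def)

lemma D_continuous: "continuous_on UNIV D"
  using s_C1 by (simp add: C1_map_def)

lemma G_matrix_continuous: "continuous_on UNIV (G_matrix s b t)"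
proof -
  have "continuous_on UNIV (\<lambda>y. D y ** b t y)"
    using D_continuous b(3) by (intro continuous_on_matrix_matrix_mult) auto
  then show ?thesis by (simp add: G_matrix_def[abs_def])
qed

lemma D_along_Linf: "continuous_on {c..d::real} x \<Longrightarrow> (\<lambda>t. D (x t)) \<in> Linf {c..d}"
  by (intro continuous_on_Linf continuous_on_compose2[OF D_continuous]) auto

lemmas a_along_Linf = Linf_along_curve[OF a]

lemmas a'_along_Linf = Linf_along_curve[OF a']

lemmas b_along_Linf = Linf_along_curve[OF b]

lemmas b'_along_Linf = Linf_along_curve[OF b']

text \<open>The inverse of \<open>G\<close> is known to be continuous in \<open>x\<close> only at the times when \<open>G\<close> is invertible
  everywhere, so its measurability along the curve is obtained from that of \<open>G\<close> by Cramer's rule.\<close>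

lemma G_inv_along_Linf:
  assumes x: "continuous_on {c..d} x"
  shows "(\<lambda>t. G_inv t (x t)) \<in> Linf {c..d}"
proof -
  have inv: "AE t in lebesgue_on {c..d}. \<forall>y. invertible (G_matrix s b t y)"
    unfolding AE_lebesgue_on_iff[OF atLeastAtMost_sets_lebesgue]
    using G_invertible by (rule eventually_mono) simp
  have "AE t in lebesgue. continuous_on UNIV (\<lambda>y. G_inv t y)"
    using G_invertible by (rule eventually_mono) (intro continuous_on_matrix_inv G_matrix_continuous, simp)
  moreover obtain R where R: "\<And>t. t \<in> {c..d} \<Longrightarrow> x t \<in> cball 0 R"
    using x by (rule continuous_curve_bounded) blast
  ultimately obtain C where C: "AE t in lebesgue_on {c..d}. \<forall>y\<in>cball 0 R. norm (G_inv t y) \<le> C"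
    using locally_ess_bounded_tx_continuous[OF G_inv_bounded] by blast
  show ?thesis
  proof (rule LinfI)
    have "(\<lambda>t. G_matrix s b t (x t)) \<in> borel_measurable (lebesgue_on {c..d})"
      unfolding G_matrix_def
      by (intro borel_measurable_matrix_matrix_mult Linf_measurable D_along_Linf b_along_Linf x)
    then show "(\<lambda>t. G_inv t (x t)) \<in> borel_measurable (lebesgue_on {c..d})"
      by (rule borel_measurable_matrix_inv) (use inv in \<open>auto elim: eventually_mono\<close>)
    show "AE t in lebesgue_on {c..d}. norm (G_inv t (x t)) \<le> C"
      using C AE_space by eventually_elim (use R in simp)
  qed
qed

lemma \<Phi>_triangle:
  obtains C where "C \<ge> 0" "(\<lambda>z. \<Phi> (fst z) (snd z)) \<in> borel_measurable (lebesgue_on (triangle c d))"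
    "AE z in lebesgue_on (triangle c d). norm (\<Phi> (fst z) (snd z)) \<le> C"
proof -
  have sub: "triangle c d \<subseteq> {(t, \<tau>). t \<ge> \<tau>}" by (auto simp: triangle_def)
  have "Linf_norm (triangle c d) (\<lambda>(t, \<tau>). \<Phi> t \<tau>) < \<infinity>"
    using \<Phi>_bounded compact_triangle sub by (simp add: locally_ess_bounded_on_def)
  then obtain C where C: "C \<ge> 0" "AE z in lebesgue_on (triangle c d). norm ((\<lambda>(t, \<tau>). \<Phi> t \<tau>) z) \<le> C"
    by (rule Linf_norm_finite_imp_AE_bound)
  show ?thesis
    using measurable_restrict_mono[OF \<Phi>_measurable sub] C
    by (intro that[of C]) (simp_all add: case_prod_unfold)
qed

lemma history_integrable_measurable:
  assumes q: "q \<in> Linf {c..d}"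
  shows history_integrable: "AE t in lebesgue_on {c..d}. integrable (lebesgue_on {c..t}) (\<lambda>\<tau>. \<Phi> t \<tau> *v q \<tau>)"
    and history_measurable: "history c q \<in> borel_measurable (lebesgue_on {c..d})"
proof -
  obtain C where C: "(\<lambda>z. \<Phi> (fst z) (snd z)) \<in> borel_measurable (lebesgue_on (triangle c d))"
      "AE z in lebesgue_on (triangle c d). norm (\<Phi> (fst z) (snd z)) \<le> C"
    by (rule \<Phi>_triangle)
  from q obtain B where B: "AE t in lebesgue_on {c..d}. norm (q t) \<le> B" by (rule LinfE)
  have "AE z in lebesgue_on (triangle c d). norm (q (snd z)) \<le> B"
    using B by (rule AE_triangle_snd)
  with C(2) have bnd: "AE z in lebesgue_on (triangle c d). norm (\<Phi> (fst z) (snd z) *v q (snd z)) \<le> C * B"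
    by eventually_elim (rule norm_matrix_vector_mult_bound)
  have meas: "(\<lambda>z. \<Phi> (fst z) (snd z) *v q (snd z)) \<in> borel_measurable (lebesgue_on (triangle c d))"
    by (rule borel_measurable_matrix_vector_mult[OF C(1) measurable_triangle_snd[OF Linf_measurable[OF q]]])
  show "AE t in lebesgue_on {c..d}. integrable (lebesgue_on {c..t}) (\<lambda>\<tau>. \<Phi> t \<tau> *v q \<tau>)"
    by (rule AE_integrable_triangle[OF meas bnd])
  show "history c q \<in> borel_measurable (lebesgue_on {c..d})"
    unfolding history_def by (rule measurable_integral_triangle[OF meas bnd])
qed

lemma history_Volterra:
  obtains C where "Volterra_operator c d C (history c)"
proof -
  obtain C where C: "C \<ge> 0" "AE z in lebesgue_on (triangle c d). norm (\<Phi> (fst z) (snd z)) \<le> C"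
    by (rule \<Phi>_triangle)
  have "Volterra_operator c d C (history c)"
  proof
    fix f :: "real \<Rightarrow> real^'n" assume f: "f \<in> Linf {c..d}"
    show "AE t in lebesgue_on {c..d}. norm (history c f t) \<le> C * (LINT \<tau>|lebesgue_on {c..t}. norm (f \<tau>))"
      using history_integrable[OF f] AE_triangle_slice[OF C(2)] AE_space
    proof eventually_elim
      case (elim t)
      have int: "integrable (lebesgue_on {c..t}) (\<lambda>\<tau>. norm (f \<tau>))"
        using elim(3) by (intro integrable_norm Linf_integrable[OF f]) auto
      have "norm (history c f t) \<le> (LINT \<tau>|lebesgue_on {c..t}. norm (\<Phi> t \<tau> *v f \<tau>))"
        unfolding history_def by (rule integral_norm_bound)
      also have "\<dots> \<le> (LINT \<tau>|lebesgue_on {c..t}. C * norm (f \<tau>))"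
      proof (rule Bochner_Integration.integral_mono_AE)
        show "integrable (lebesgue_on {c..t}) (\<lambda>\<tau>. norm (\<Phi> t \<tau> *v f \<tau>))"
          using elim(1) by (rule integrable_norm)
        show "integrable (lebesgue_on {c..t}) (\<lambda>\<tau>. C * norm (f \<tau>))"
          using int by (rule integrable_mult_right)
        show "AE \<tau> in lebesgue_on {c..t}. norm (\<Phi> t \<tau> *v f \<tau>) \<le> C * norm (f \<tau>)"
          using elim(2) by (rule eventually_mono) (rule norm_matrix_vector_mult_bound, simp_all)
      qed
      also have "\<dots> = C * (LINT \<tau>|lebesgue_on {c..t}. norm (f \<tau>))"
        by (rule integral_mult_right_zero)
      finally show ?case .
    qed
    show "AE t in lebesgue_on {c..d}. history c (\<lambda>\<tau>. f \<tau> + g \<tau>) t = history c f t + history c g t"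
      if g: "g \<in> Linf {c..d}" for g
      using history_integrable[OF f] history_integrable[OF g]
      by eventually_elim (simp add: history_def matrix_vector_right_distrib)
    show "AE t in lebesgue_on {c..d}. history c (\<lambda>\<tau>. r *\<^sub>R f \<tau>) t = r *\<^sub>R history c f t" for r
      by (simp add: history_def matrix_vector_mult_scaleR)
  qed (use C(1) history_measurable in auto)
  then show ?thesis by (rule that)
qed

lemma history_Linf: "q \<in> Linf {c..d} \<Longrightarrow> history c q \<in> Linf {c..d}"
  by (rule history_Volterra[of c d]) (rule Volterra_operator.K_Linf)

lemma history_diff:
  assumes f: "f \<in> Linf {c..d}" and g: "g \<in> Linf {c..d}"
  shows "AE t in lebesgue_on {c..d}. history c (\<lambda>\<tau>. f \<tau> - g \<tau>) t = history c f t - history c g t"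
  using history_integrable[OF f] history_integrable[OF g]
  by eventually_elim (simp add: history_def matrix_vector_mult_diff_distrib)

text \<open>The factors of the kernel that depend on \<open>t\<close> alone can be moved out of the integral, so the properties
  of the sliding operator are inherited from \<open>history\<close>. This requires integrability, hence only
  almost every \<open>t\<close>.\<close>

lemma sliding_operator_eq_history:
  assumes x: "continuous_on {c..d} x" and v: "v \<in> Linf {c..d}"
  shows "AE t in lebesgue_on {c..d}. sliding_operator s b \<Phi> b' x c v t =
    - (G_inv t (x t) *v (D (x t) *v history c (\<lambda>\<tau>. b' \<tau> (x \<tau>) *v v \<tau>) t))"
  using history_integrable[OF Linf_matrix_vector_mult[OF b'_along_Linf[OF x] v]]
proof eventually_elim
  case (elim t)
  have "bounded_linear (\<lambda>w. G_inv t (x t) *v (D (x t) *v w))"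
    by (intro bounded_linear_compose[OF matrix_vector_mul_bounded_linear] matrix_vector_mul_bounded_linear)
  from integral_bounded_linear[OF this elim] show ?case
    by (simp add: sliding_operator_def history_def matrix_vector_mul_assoc matrix_mul_assoc)
qed

lemma sliding_operator_Volterra:
  assumes x: "continuous_on {c..d} x"
  obtains M where "Volterra_operator c d M (sliding_operator s b \<Phi> b' x c)"
proof -
  obtain C where C: "Volterra_operator c d C (history c)" by (rule history_Volterra)
  interpret H: Volterra_operator c d C "history c" by (rule C)
  define K where "K v t = - (G_inv t (x t) *v (D (x t) *v history c (\<lambda>\<tau>. b' \<tau> (x \<tau>) *v v \<tau>) t))" for v t
  have eq: "AE t in lebesgue_on {c..d}. sliding_operator s b \<Phi> b' x c v t = K v t" if "v \<in> Linf {c..d}" for v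
    unfolding K_def using sliding_operator_eq_history[OF x that] .
  have bv: "(\<lambda>\<tau>. b' \<tau> (x \<tau>) *v v \<tau>) \<in> Linf {c..d}" if "v \<in> Linf {c..d}" for v
    using b'_along_Linf[OF x] that by (rule Linf_matrix_vector_mult)
  obtain C1 where C1: "C1 \<ge> 0" "AE t in lebesgue_on {c..d}. norm (G_inv t (x t)) \<le> C1"
    using G_inv_along_Linf[OF x] by (rule LinfE)
  obtain C2 where C2: "C2 \<ge> 0" "AE t in lebesgue_on {c..d}. norm (D (x t)) \<le> C2"
    using D_along_Linf[OF x] by (rule LinfE)
  obtain C3 where C3: "C3 \<ge> 0" "AE t in lebesgue_on {c..d}. norm (b' t (x t)) \<le> C3"
    using b'_along_Linf[OF x] by (rule LinfE)
  have "Volterra_operator c d (C1 * (C2 * (C * C3))) (sliding_operator s b \<Phi> b' x c)"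
  proof
    show "0 \<le> C1 * (C2 * (C * C3))"
      using C1(1) C2(1) C3(1) H.M_nonneg by simp
    fix f :: "real \<Rightarrow> real^'m" assume f: "f \<in> Linf {c..d}"
    have "K f \<in> Linf {c..d}"
      unfolding K_def
      by (intro Linf_minus Linf_matrix_vector_mult G_inv_along_Linf D_along_Linf x history_Linf b'_along_Linf f)
    then show "sliding_operator s b \<Phi> b' x c f \<in> borel_measurable (lebesgue_on {c..d})"
      using eq[OF f] by (intro borel_measurable_lebesgue_on_AE[OF Linf_measurable]) (auto simp: eq_commute)
    show "AE t in lebesgue_on {c..d}. sliding_operator s b \<Phi> b' x c (\<lambda>\<tau>. f \<tau> + g \<tau>) t =
        sliding_operator s b \<Phi> b' x c f t + sliding_operator s b \<Phi> b' x c g t" if g: "g \<in> Linf {c..d}" for g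
      using eq[OF f] eq[OF g] eq[OF Linf_add[OF f g]] H.K_add[OF bv[OF f] bv[OF g]]
      by eventually_elim (simp add: K_def matrix_vector_right_distrib)
    show "AE t in lebesgue_on {c..d}. sliding_operator s b \<Phi> b' x c (\<lambda>\<tau>. r *\<^sub>R f \<tau>) t =
        r *\<^sub>R sliding_operator s b \<Phi> b' x c f t" for r
      using eq[OF f] eq[OF Linf_scaleR[OF f, of r]] H.K_scaleR[OF bv[OF f], of r]
      by eventually_elim (simp add: K_def matrix_vector_mult_scaleR)
    show "AE t in lebesgue_on {c..d}. norm (sliding_operator s b \<Phi> b' x c f t)
        \<le> C1 * (C2 * (C * C3)) * (LINT \<tau>|lebesgue_on {c..t}. norm (f \<tau>))"
      using eq[OF f] H.K_bound[OF bv[OF f]] C1(2) C2(2) AE_space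
    proof eventually_elim
      case (elim t)
      let ?F = "LINT \<tau>|lebesgue_on {c..t}. norm (f \<tau>)"
      have t: "t \<le> d" using elim(5) by simp
      have "(LINT \<tau>|lebesgue_on {c..t}. norm (b' \<tau> (x \<tau>) *v f \<tau>)) \<le> (LINT \<tau>|lebesgue_on {c..t}. C3 * norm (f \<tau>))"
      proof (rule Bochner_Integration.integral_mono_AE)
        show "integrable (lebesgue_on {c..t}) (\<lambda>\<tau>. norm (b' \<tau> (x \<tau>) *v f \<tau>))"
          using t by (intro integrable_norm Linf_integrable[OF bv[OF f]]) auto
        show "integrable (lebesgue_on {c..t}) (\<lambda>\<tau>. C3 * norm (f \<tau>))"
          using t by (intro integrable_mult_right integrable_norm Linf_integrable[OF f]) auto
        show "AE \<tau> in lebesgue_on {c..t}. norm (b' \<tau> (x \<tau>) *v f \<tau>) \<le> C3 * norm (f \<tau>)"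
          using AE_interval_subset[OF C3(2) order_refl t]
          by (rule eventually_mono) (rule norm_matrix_vector_mult_bound, simp_all)
      qed
      also have "\<dots> = C3 * ?F" by (rule integral_mult_right_zero)
      finally have "C * (LINT \<tau>|lebesgue_on {c..t}. norm (b' \<tau> (x \<tau>) *v f \<tau>)) \<le> C * (C3 * ?F)"
        using H.M_nonneg by (rule mult_left_mono)
      with elim(2) have "norm (history c (\<lambda>\<tau>. b' \<tau> (x \<tau>) *v f \<tau>) t) \<le> C * (C3 * ?F)"
        by linarith
      with elim(3,4) have "norm (K f t) \<le> C1 * (C2 * (C * (C3 * ?F)))"
        unfolding K_def norm_minus_cancel by (intro norm_matrix_vector_mult_bound)
      with elim(1) show ?case by (simp add: mult.assoc)
    qed
  qed
  then show ?thesis by (rule that)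
qed

definition force :: "(real \<Rightarrow> real^'n) \<Rightarrow> (real \<Rightarrow> real^'m) \<Rightarrow> real \<Rightarrow> real^'n" where
  "force x v \<tau> = a' \<tau> (x \<tau>) + b' \<tau> (x \<tau>) *v v \<tau>"

definition velocity :: "real \<Rightarrow> (real \<Rightarrow> real^'n) \<Rightarrow> (real \<Rightarrow> real^'m) \<Rightarrow> real \<Rightarrow> real^'n" where
  "velocity t0 x v t = a t (x t) + b t (x t) *v v t + history t0 (force x v) t"

text \<open>A solution on a compact interval together with its control. The control is recorded as
  essentially bounded, which \<open>Utkin_control_Linf\<close> provides, because all integral operators here act on
  essentially bounded functions.\<close>

definition solves :: "real \<Rightarrow> real \<Rightarrow> (real \<Rightarrow> real^'n) \<Rightarrow> (real \<Rightarrow> real^'m) \<Rightarrow> bool" where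
  "solves t0 T x v \<longleftrightarrow> t0 \<le> T \<and> absolutely_continuous_fun_on {t0..T} x \<and> v \<in> Linf {t0..T} \<and>
     (AE t in lebesgue_on {t0..T}. v t \<in> Utkin_set u t (x t)) \<and>
     (AE t in lebesgue_on {t0..T}. (x has_vector_derivative velocity t0 x v t) (at t within {t0..T}))"

lemma solves_continuous: "solves t0 T x v \<Longrightarrow> continuous_on {t0..T} x"
  unfolding solves_def by (blast intro: absolutely_continuous_fun_on_imp_continuous_on)

lemma force_Linf: "continuous_on {c..d} x \<Longrightarrow> v \<in> Linf {c..d} \<Longrightarrow> force x v \<in> Linf {c..d}"
  unfolding force_def[abs_def]
  by (intro Linf_add Linf_matrix_vector_mult a'_along_Linf b'_along_Linf)

lemma velocity_Linf: "continuous_on {c..d} x \<Longrightarrow> v \<in> Linf {c..d} \<Longrightarrow> velocity c x v \<in> Linf {c..d}"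
  unfolding velocity_def[abs_def]
  by (intro Linf_add Linf_matrix_vector_mult a_along_Linf b_along_Linf history_Linf force_Linf)

text \<open>Near the bounded curve almost all values of \<open>u t\<close> lie in a fixed ball, for almost every \<open>t\<close>, and
  a Filippov set does not leave a closed ball that contains almost all nearby values.\<close>

lemma Utkin_control_Linf:
  assumes x: "continuous_on {c..d} x" and v: "v \<in> borel_measurable (lebesgue_on {c..d})"
    and U: "AE t in lebesgue_on {c..d}. v t \<in> Utkin_set u t (x t)"
  shows "v \<in> Linf {c..d}"
proof -
  obtain R where R: "\<And>t. t \<in> {c..d} \<Longrightarrow> x t \<in> cball 0 R"
    using x by (rule continuous_curve_bounded) blast
  obtain C where C: "C \<ge> 0"
      "AE t in lebesgue_on {c..d}. AE y in lebesgue. y \<in> cball 0 (R + 1) \<longrightarrow> norm (u t y) \<le> C"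
    using u_bounded by (rule locally_ess_bounded_tx_AE)
  have "AE t in lebesgue_on {c..d}. norm (v t) \<le> real CARD('m) * C"
    using C(2) U AE_space
  proof eventually_elim
    case (elim t)
    have "ball (x t) 1 \<subseteq> cball 0 (R + 1)"
    proof
      fix y assume "y \<in> ball (x t) 1"
      moreover have "norm (x t) \<le> R" using R[of t] elim(3) by simp
      ultimately show "y \<in> cball 0 (R + 1)"
        using norm_triangle_ineq2[of y "x t"] by (simp add: dist_norm norm_minus_commute)
    qed
    then have "AE y in lebesgue. y \<in> ball (x t) 1 \<longrightarrow> norm (u t y) \<le> C"
      using elim(1) by (intro eventually_mono[OF elim(1)]) blast
    then show ?case
      using Utkin_set_bounded[of "x t" 1 u t C "v t"] C(1) elim(2) by simp
  qed
  with v show ?thesis by (rule LinfI)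
qed

lemma Utkin_solution_solves:
  assumes sol: "Utkin_solution_with a b \<Phi> a' b' u t0 x0 I x v" and sub: "{t0..T} \<subseteq> I" and "t0 \<le> T"
  shows "solves t0 T x v" and "x t0 = x0"
proof -
  from sol have *: "interval_from t0 I \<and> (\<forall>c d. {c..d} \<subseteq> I \<longrightarrow> absolutely_continuous_fun_on {c..d} x) \<and>
     x t0 = x0 \<and> v \<in> borel_measurable (lebesgue_on I) \<and>
     (AE t in lebesgue_on I. v t \<in> Utkin_set u t (x t) \<and>
        (x has_vector_derivative velocity t0 x v t) (at t within I))"
    unfolding Utkin_solution_with_def Utkin_first_kind_def Utkin_second_kind_def solution_with_control_def
      velocity_def history_def force_def Utkin_set_def
    by (auto elim!: eventually_mono)
  then show "x t0 = x0" by blast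
  have I: "I \<in> sets lebesgue"
    using * real_interval_borel_measurable[of I] by (simp add: interval_from_def)
  have ac: "absolutely_continuous_fun_on {t0..T} x" using * sub by blast
  have v: "v \<in> borel_measurable (lebesgue_on {t0..T})"
    using * sub by (blast intro: measurable_restrict_mono)
  have ae: "AE t in lebesgue_on {t0..T}. v t \<in> Utkin_set u t (x t) \<and>
        (x has_vector_derivative velocity t0 x v t) (at t within I)"
    using * by (intro AE_lebesgue_on_subset[OF _ sub _ I]) simp_all
  have U: "AE t in lebesgue_on {t0..T}. v t \<in> Utkin_set u t (x t)"
    using ae by (rule eventually_mono) simp
  have der: "AE t in lebesgue_on {t0..T}. (x has_vector_derivative velocity t0 x v t) (at t within {t0..T})"
    using ae by (rule eventually_mono) (auto elim!: has_vector_derivative_within_subset[OF _ sub])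
  have "v \<in> Linf {t0..T}"
    using absolutely_continuous_fun_on_imp_continuous_on[OF ac] v U by (rule Utkin_control_Linf)
  with ac U der \<open>t0 \<le> T\<close> show "solves t0 T x v" by (simp add: solves_def)
qed

section \<open>The equivalent control\<close>

text \<open>The derivative of the constant \<open>s (x t)\<close> is \<open>D (x t) *v velocity t0 x v t\<close>. Setting it to zero gives a linear equation
  for \<open>v t\<close> with the invertible matrix \<open>G_matrix s b t (x t)\<close>.\<close>

lemma equivalent_control:
  assumes sol: "solves t0 T x v" and "t0 \<le> ts" and S: "\<forall>t\<in>{ts..T}. s (x t) = 0"
  shows "AE t in lebesgue_on {ts..T}.
    v t = - (G_inv t (x t) *v (D (x t) *v (a t (x t) + history t0 (force x v) t)))"
proof -
  have "AE t in lebesgue_on {t0..T}. (x has_vector_derivative velocity t0 x v t) (at t within {t0..T})"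
    using sol by (simp add: solves_def)
  then have "AE t in lebesgue_on {ts..T}. (x has_vector_derivative velocity t0 x v t) (at t within {t0..T})"
    using \<open>t0 \<le> ts\<close> by (rule AE_interval_subset) simp
  then have der: "AE t in lebesgue_on {ts<..<T}. (x has_vector_derivative velocity t0 x v t) (at t within {t0..T})"
    by (simp add: AE_open_interval_iff)
  have inv: "AE t in lebesgue_on {ts<..<T}. \<forall>y. invertible (G_matrix s b t y)"
    using G_invertible by (subst AE_lebesgue_on_iff) (auto elim: eventually_mono)
  show ?thesis
    unfolding AE_open_interval_iff[symmetric]
    using der inv AE_space
  proof eventually_elim
    case (elim t)
    then have t: "ts < t" "t < T" by simp_all
    have "(x has_vector_derivative velocity t0 x v t) (at t within {ts..T})"
      by (rule has_vector_derivative_within_subset[OF elim(1)]) (use \<open>t0 \<le> ts\<close> in auto)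
    then have "((\<lambda>t. s (x t)) has_derivative (\<lambda>h. D (x t) *v (h *\<^sub>R velocity t0 x v t))) (at t within {ts..T})"
      unfolding has_vector_derivative_def by (rule has_derivative_compose[OF _ s_derivative])
    then have "((\<lambda>t. s (x t)) has_vector_derivative D (x t) *v velocity t0 x v t) (at t within {ts..T})"
      by (simp add: has_vector_derivative_def matrix_vector_mult_scaleR)
    moreover have "((\<lambda>t. s (x t)) has_vector_derivative 0) (at t within {ts..T})"
      by (rule has_vector_derivative_transform[OF _ _ has_vector_derivative_const[of 0]]) (use S t in auto)
    ultimately have "D (x t) *v velocity t0 x v t = 0"
      using t by (intro vector_derivative_unique_within_closed_interval[of ts T t]) auto
    then have "G_matrix s b t (x t) *v v t = - (D (x t) *v (a t (x t) + history t0 (force x v) t))"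
      by (simp add: velocity_def G_matrix_def matrix_vector_right_distrib matrix_vector_mul_assoc[symmetric]
          algebra_simps add_eq_0_iff)
    then have "G_inv t (x t) *v (G_matrix s b t (x t) *v v t) =
        G_inv t (x t) *v (- (D (x t) *v (a t (x t) + history t0 (force x v) t)))"
      by simp
    moreover have "G_inv t (x t) *v (G_matrix s b t (x t) *v v t) = v t"
      using invertible_matrix_inv_left[of "G_matrix s b t (x t)"] elim(2)
      by (simp add: matrix_vector_mul_assoc)
    ultimately show ?case
      using matrix_vector_mult_scaleR[of "G_inv t (x t)" "-1"] by simp
  qed
qed

lemma control_before_sliding:
  assumes sol: "solves t0 T x v" and off: "\<forall>t\<in>{t0..<ts}. s (x t) \<noteq> 0"
  shows "AE t in lebesgue_on {t0..T}. t < ts \<longrightarrow> v t = u t (x t)"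
proof -
  have "AE t in lebesgue_on {t0..T}. \<forall>y. y \<notin> {x. s x = 0} \<longrightarrow> Utkin_set u t y \<subseteq> {u t y}"
    unfolding AE_lebesgue_on_iff[OF atLeastAtMost_sets_lebesgue]
    using piecewise_Lipschitz_tx_Utkin_set[OF u_piecewise] by (rule eventually_mono) blast
  moreover have "AE t in lebesgue_on {t0..T}. v t \<in> Utkin_set u t (x t)"
    using sol by (simp add: solves_def)
  ultimately show ?thesis
    using AE_space
  proof eventually_elim
    case (elim t)
    show ?case
    proof
      assume "t < ts"
      with off elim(3) have "x t \<notin> {x. s x = 0}" by simp
      with elim(1,2) show "v t = u t (x t)" by blast
    qed
  qed
qed

text \<open>The memory term in the formula for the equivalent control is split at \<open>ts\<close>. Before \<open>ts\<close> the control
  equals \<open>u\<close> along the curve; after \<open>ts\<close> its contribution is the sliding operator applied to it.\<close>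

lemma sliding_fixed_point:
  assumes sol: "solves t0 T x v" and ts: "t0 \<le> ts" "ts \<le> T"
    and off: "\<forall>t\<in>{t0..<ts}. s (x t) \<noteq> 0" and on: "\<forall>t\<in>{ts..T}. s (x t) = 0"
  shows "AE t in lebesgue_on {ts..T}.
    v t = sliding_g s a b \<Phi> a' b' u x t0 ts t + sliding_operator s b \<Phi> b' x ts v t"
proof -
  have v: "v \<in> Linf {t0..T}" using sol by (simp add: solves_def)
  have x: "continuous_on {t0..T} x" using sol by (rule solves_continuous)
  have vs: "v \<in> Linf {ts..T}" using v ts(1) by (rule Linf_subset_interval) simp
  have xs: "continuous_on {ts..T} x" using x by (rule continuous_on_subset) (use ts in auto)
  have v_eq: "AE \<tau> in lebesgue_on {t0..ts}. v \<tau> = u \<tau> (x \<tau>)"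
    unfolding AE_open_interval_iff[symmetric]
    using AE_lebesgue_on_subset[OF control_before_sliding[OF sol off], of "{t0<..<ts}"] AE_space
    by (rule eventually_elim2) (use ts in auto)
  have int: "AE t in lebesgue_on {ts..T}. integrable (lebesgue_on {t0..t}) (\<lambda>\<tau>. \<Phi> t \<tau> *v force x v \<tau>)"
    by (rule AE_interval_subset[OF history_integrable[OF force_Linf[OF x v]] ts(1)]) simp
  have int1: "AE t in lebesgue_on {ts..T}. integrable (lebesgue_on {ts..t}) (\<lambda>\<tau>. \<Phi> t \<tau> *v a' \<tau> (x \<tau>))"
    by (rule history_integrable[OF a'_along_Linf[OF xs]])
  have int2: "AE t in lebesgue_on {ts..T}. integrable (lebesgue_on {ts..t}) (\<lambda>\<tau>. \<Phi> t \<tau> *v (b' \<tau> (x \<tau>) *v v \<tau>))"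
    by (rule history_integrable[OF Linf_matrix_vector_mult[OF b'_along_Linf[OF xs] vs]])
  show ?thesis
    using equivalent_control[OF sol ts(1) on] sliding_operator_eq_history[OF xs vs] int int1 int2 AE_space
  proof eventually_elim
    case (elim t)
    then have t: "ts \<le> t" "t \<le> T" by simp_all
    have int0: "integrable (lebesgue_on {t0..ts}) (\<lambda>\<tau>. \<Phi> t \<tau> *v force x v \<tau>)"
      by (rule integrable_lebesgue_on_subset[OF elim(3)]) (use t in auto)
    have eq0: "AE \<tau> in lebesgue_on {t0..ts}. \<Phi> t \<tau> *v force x v \<tau> =
        \<Phi> t \<tau> *v (a' \<tau> (x \<tau>) + b' \<tau> (x \<tau>) *v u \<tau> (x \<tau>))"
      using v_eq by (rule eventually_mono) (simp add: force_def)
    have m0: "(\<lambda>\<tau>. \<Phi> t \<tau> *v force x v \<tau>) \<in> borel_measurable (lebesgue_on {t0..ts})"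
      using int0 by (rule borel_measurable_integrable)
    have "(LINT \<tau>|lebesgue_on {t0..ts}. \<Phi> t \<tau> *v force x v \<tau>) =
        (LINT \<tau>|lebesgue_on {t0..ts}. \<Phi> t \<tau> *v (a' \<tau> (x \<tau>) + b' \<tau> (x \<tau>) *v u \<tau> (x \<tau>)))"
      by (rule integral_cong_AE[OF m0 borel_measurable_lebesgue_on_AE[OF m0 eq0] eq0]) simp
    moreover have "(LINT \<tau>|lebesgue_on {ts..t}. \<Phi> t \<tau> *v force x v \<tau>) =
        (LINT \<tau>|lebesgue_on {ts..t}. \<Phi> t \<tau> *v a' \<tau> (x \<tau>)) + history ts (\<lambda>\<tau>. b' \<tau> (x \<tau>) *v v \<tau>) t"
      unfolding force_def history_def matrix_vector_right_distrib
      by (rule Bochner_Integration.integral_add[OF elim(4,5)])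
    ultimately have "history t0 (force x v) t =
        sliding_g_tilde \<Phi> a' b' u x t0 ts t + history ts (\<lambda>\<tau>. b' \<tau> (x \<tau>) *v v \<tau>) t"
      unfolding sliding_g_tilde_def history_def[of t0]
      using LINT_interval_combine[OF elim(3) ts(1) t(1)] by simp
    with elim(1,2) show ?case
      by (simp add: sliding_g_def matrix_vector_right_distrib)
  qed
qed

theorem equivalent_control_Neumann:
  assumes sol: "solves t0 T x v" and ts: "t0 \<le> ts" "ts \<le> T"
    and off: "\<forall>t\<in>{t0..<ts}. s (x t) \<noteq> 0" and on: "\<forall>t\<in>{ts..T}. s (x t) = 0"
  defines "K \<equiv> sliding_operator s b \<Phi> b' x ts"
    and "g \<equiv> sliding_g s a b \<Phi> a' b' u x t0 ts"
  shows "bounded_linear_Linf {ts<..<T} K"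
    and "g \<in> Linf {ts<..<T}"
    and "(\<lambda>k. Linf_norm {ts<..<T} (\<lambda>t. v t - (\<Sum>i<k. (K ^^ i) g t))) \<longlonglongrightarrow> 0"
    and "AE t in lebesgue_on {t0..T}. v t = (if t < ts then u t (x t) else (\<Sum>i. (K ^^ i) g t))"
proof -
  have v: "v \<in> Linf {t0..T}" using sol by (simp add: solves_def)
  have vs: "v \<in> Linf {ts..T}" using v ts(1) by (rule Linf_subset_interval) simp
  have xs: "continuous_on {ts..T} x"
    using solves_continuous[OF sol] by (rule continuous_on_subset) (use ts in auto)
  obtain M where M: "Volterra_operator ts T M K"
    using sliding_operator_Volterra[OF xs] unfolding K_def .
  interpret Volterra_operator ts T M K by (rule M)
  have fp: "AE t in lebesgue_on {ts..T}. v t = g t + K v t"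
    unfolding g_def K_def using sol ts off on by (rule sliding_fixed_point)
  \<comment> \<open>The measurability of \<open>g\<close>, with its two integrals depending on \<open>t\<close>, comes for free from the
    fixed point equation.\<close>
  have g: "g \<in> Linf {ts..T}"
  proof (rule Linf_cong_AE)
    show "(\<lambda>t. v t - K v t) \<in> Linf {ts..T}"
      using vs by (intro Linf_diff K_Linf)
    show "AE t in lebesgue_on {ts..T}. v t - K v t = g t"
      using fp by (rule eventually_mono) (simp add: algebra_simps)
  qed simp
  show "bounded_linear_Linf {ts<..<T} K"
    by (rule bounded_linear_K)
  show "g \<in> Linf {ts<..<T}"
    using g by (simp add: Linf_open_interval)
  show "(\<lambda>k. Linf_norm {ts<..<T} (\<lambda>t. v t - (\<Sum>i<k. (K ^^ i) g t))) \<longlonglongrightarrow> 0"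
    using vs g fp by (rule Neumann_series)
  have series: "AE t in lebesgue. t \<in> {ts..T} \<longrightarrow> v t = (\<Sum>i. (K ^^ i) g t)"
    using Neumann_series(2)[OF vs g fp] by (simp only: AE_lebesgue_on_iff[OF atLeastAtMost_sets_lebesgue])
  have "AE t in lebesgue. t \<in> {t0..T} \<longrightarrow> t < ts \<longrightarrow> v t = u t (x t)"
    using control_before_sliding[OF sol off] by (simp only: AE_lebesgue_on_iff[OF atLeastAtMost_sets_lebesgue])
  with series show "AE t in lebesgue_on {t0..T}. v t = (if t < ts then u t (x t) else (\<Sum>i. (K ^^ i) g t))"
    unfolding AE_lebesgue_on_iff[OF atLeastAtMost_sets_lebesgue]
    by eventually_elim auto
qed

section \<open>Uniqueness on the sliding surface\<close>

text \<open>All quantities that differ between the two solutions are estimated by \<open>E t\<close>, the integral of \<open>e\<close> over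
  the past, which is nondecreasing and dominates the distance of the trajectories. On the surface \<open>b'\<close> and the inverse of
  \<open>G\<close> are the same for both solutions, so the difference of the forces involves only the differences of
  \<open>a'\<close> and of the controls.\<close>

lemma solves_unique_on_manifold:
  assumes Lip: "locally_Lipschitz_tx a" "locally_Lipschitz_tx b" "locally_Lipschitz_tx a'"
      "locally_Lipschitz_tx (\<lambda>t. D)"
    and G_const: "\<And>t y1 y2. s y1 = 0 \<Longrightarrow> s y2 = 0 \<Longrightarrow> G_matrix s b t y1 = G_matrix s b t y2"
    and b'_const: "\<And>t y1 y2. s y1 = 0 \<Longrightarrow> s y2 = 0 \<Longrightarrow> b' t y1 = b' t y2"
    and x: "solves t0 T x v" "\<forall>t\<in>{t0..T}. s (x t) = 0"
    and y: "solves t0 T y w" "\<forall>t\<in>{t0..T}. s (y t) = 0"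
    and start: "x t0 = y t0"
  shows "x T = y T"
proof -
  have "t0 \<le> T" using x(1) by (simp add: solves_def)
  have xc: "continuous_on {t0..T} x" and yc: "continuous_on {t0..T} y"
    using x(1) y(1) by (auto dest: solves_continuous)
  have v: "v \<in> Linf {t0..T}" and w: "w \<in> Linf {t0..T}"
    using x(1) y(1) by (auto simp: solves_def)
  define dv where "dv t = velocity t0 x v t - velocity t0 y w t" for t
  define e where "e t = norm (v t - w t) + norm (dv t)" for t
  define E where "E t = (LINT \<tau>|lebesgue_on {t0..t}. e \<tau>)" for t
  have dv: "dv \<in> Linf {t0..T}"
    unfolding dv_def[abs_def] by (intro Linf_diff velocity_Linf xc yc v w)
  have vw: "(\<lambda>t. v t - w t) \<in> Linf {t0..T}"
    using v w by (rule Linf_diff)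
  obtain B1 where B1: "AE t in lebesgue_on {t0..T}. norm (v t - w t) \<le> B1" using vw by (rule LinfE)
  obtain B2 where B2: "AE t in lebesgue_on {t0..T}. norm (dv t) \<le> B2" using dv by (rule LinfE)
  have e_meas: "e \<in> borel_measurable (lebesgue_on {t0..T})"
    unfolding e_def[abs_def]
    using Linf_measurable[OF vw] Linf_measurable[OF dv] by simp
  have e_nonneg: "0 \<le> e t" for t by (simp add: e_def)
  have e_bound: "AE t in lebesgue_on {t0..T}. e t \<le> B1 + B2"
    using B1 B2 by eventually_elim (simp add: e_def)
  have e_int: "integrable (lebesgue_on {t0..t}) e" if "t \<le> T" for t
    by (rule integrable_interval[OF e_meas, of "B1 + B2"]) (use e_bound e_nonneg that in auto)
  have E_nonneg: "0 \<le> E t" for t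
    unfolding E_def by (rule Bochner_Integration.integral_nonneg) (rule e_nonneg)
  have E_mono: "E \<tau> \<le> E t" if "t0 \<le> \<tau>" "\<tau> \<le> t" "t \<le> T" for \<tau> t
  proof -
    have "E t = E \<tau> + (LINT \<sigma>|lebesgue_on {\<tau>..t}. e \<sigma>)"
      unfolding E_def by (rule LINT_interval_combine[OF e_int that(1,2)]) (use that in simp)
    moreover have "0 \<le> (LINT \<sigma>|lebesgue_on {\<tau>..t}. e \<sigma>)"
      by (rule Bochner_Integration.integral_nonneg) (rule e_nonneg)
    ultimately show ?thesis by simp
  qed
  have dist: "norm (x t - y t) \<le> E t" if t: "t \<in> {t0..T}" for t
  proof -
    have sub: "{t0..t} \<subseteq> {t0..T}" "t0 \<le> t" "t \<le> T" using t by auto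
    have "(velocity t0 z c has_integral (z t - z t0)) {t0..t}" if z: "solves t0 T z c" for z c
    proof (rule absolutely_continuous_has_integral)
      show "absolutely_continuous_fun_on {t0..t} z"
        using z sub(1) by (auto simp: solves_def intro: absolutely_continuous_fun_on_subset)
      have "AE \<tau> in lebesgue_on {t0..T}. (z has_vector_derivative velocity t0 z c \<tau>) (at \<tau> within {t0..T})"
        using z by (simp add: solves_def)
      then have "AE \<tau> in lebesgue_on {t0..t}. (z has_vector_derivative velocity t0 z c \<tau>) (at \<tau> within {t0..T})"
        by (rule AE_interval_subset[OF _ order_refl sub(3)])
      then show "AE \<tau> in lebesgue_on {t0..t}. (z has_vector_derivative velocity t0 z c \<tau>) (at \<tau> within {t0..t})"
        by (rule eventually_mono) (rule has_vector_derivative_within_subset[OF _ sub(1)])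
    qed (rule sub(2))
    from has_integral_diff[OF this[OF x(1)] this[OF y(1)]]
    have "(dv has_integral (x t - y t)) {t0..t}"
      unfolding dv_def[abs_def] using start by simp
    moreover have "dv \<in> Linf {t0..t}"
      by (rule Linf_subset_interval[OF dv order_refl sub(3)])
    ultimately have "norm (x t - y t) \<le> (LINT \<tau>|lebesgue_on {t0..t}. norm (dv \<tau>))"
      by (rule has_integral_norm_le_LINT)
    also have "\<dots> \<le> E t"
      unfolding E_def
      by (rule Bochner_Integration.integral_mono_AE[OF integrable_norm[OF Linf_integrable[OF dv order_refl sub(3)]] e_int[OF sub(3)]])
        (simp add: e_def)
    finally show ?thesis .
  qed
  have start_le: "t0 \<le> t0" ..
  obtain Ca where Ca: "AE t in lebesgue_on {t0..T}. norm (a t (x t) + history t0 (force x v) t) \<le> Ca" "Ca \<ge> 0"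
    using Linf_add[OF a_along_Linf[OF xc] history_Linf[OF force_Linf[OF xc v]]] by (rule LinfE)
  obtain Cb where Cb: "AE t in lebesgue_on {t0..T}. norm (b t (y t)) \<le> Cb" "Cb \<ge> 0"
    using b_along_Linf[OF yc] by (rule LinfE)
  obtain Cb' where Cb': "AE t in lebesgue_on {t0..T}. norm (b' t (y t)) \<le> Cb'" "Cb' \<ge> 0"
    using b'_along_Linf[OF yc] by (rule LinfE)
  obtain Cv where Cv: "AE t in lebesgue_on {t0..T}. norm (v t) \<le> Cv" "Cv \<ge> 0"
    using v by (rule LinfE)
  obtain Cd where Cd: "AE t in lebesgue_on {t0..T}. norm (D (y t)) \<le> Cd" "Cd \<ge> 0"
    using D_along_Linf[OF yc] by (rule LinfE)
  obtain Cg where Cg: "AE t in lebesgue_on {t0..T}. norm (G_inv t (y t)) \<le> Cg" "Cg \<ge> 0"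
    using G_inv_along_Linf[OF yc] by (rule LinfE)
  obtain La where La: "La \<ge> 0" "AE t in lebesgue_on {t0..T}. norm (a t (x t) - a t (y t)) \<le> La * norm (x t - y t)"
    using Lip(1) xc yc by (rule locally_Lipschitz_along_curves)
  obtain Lb where Lb: "Lb \<ge> 0" "AE t in lebesgue_on {t0..T}. norm (b t (x t) - b t (y t)) \<le> Lb * norm (x t - y t)"
    using Lip(2) xc yc by (rule locally_Lipschitz_along_curves)
  obtain La' where La': "La' \<ge> 0" "AE t in lebesgue_on {t0..T}. norm (a' t (x t) - a' t (y t)) \<le> La' * norm (x t - y t)"
    using Lip(3) xc yc by (rule locally_Lipschitz_along_curves)
  obtain Ld where Ld: "Ld \<ge> 0" "AE t in lebesgue_on {t0..T}. norm (D (x t) - D (y t)) \<le> Ld * norm (x t - y t)"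
    using Lip(4) xc yc by (rule locally_Lipschitz_along_curves)
  obtain C\<Phi> where C\<Phi>: "Volterra_operator t0 T C\<Phi> (history t0)"
    by (rule history_Volterra)
  interpret H: Volterra_operator t0 T C\<Phi> "history t0" by (rule C\<Phi>)
  have force_diff: "AE \<tau> in lebesgue_on {t0..T}.
      norm (force x v \<tau> - force y w \<tau>) \<le> La' * norm (x \<tau> - y \<tau>) + Cb' * e \<tau>"
    using La'(2) Cb'(1) AE_space
  proof eventually_elim
    case (elim \<tau>)
    have "b' \<tau> (x \<tau>) = b' \<tau> (y \<tau>)"
      using elim(3) x(2) y(2) by (intro b'_const) auto
    then have "force x v \<tau> - force y w \<tau> = (a' \<tau> (x \<tau>) - a' \<tau> (y \<tau>)) + b' \<tau> (y \<tau>) *v (v \<tau> - w \<tau>)"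
      by (simp add: force_def matrix_vector_mult_diff_distrib)
    also have "norm \<dots> \<le> La' * norm (x \<tau> - y \<tau>) + Cb' * e \<tau>"
      using elim(1,2) by (intro norm_triangle_mono norm_matrix_vector_mult_bound) (auto simp: e_def)
    finally show ?case .
  qed
  \<comment> \<open>The distance of the trajectories before \<open>t\<close> is at most \<open>E t\<close>, which is constant under
    the integral and contributes the factor \<open>T - t0\<close>.\<close>
  define Ch where "Ch = C\<Phi> * (La' * (T - t0) + Cb')"
  have Ch: "Ch \<ge> 0"
    using H.M_nonneg La'(1) Cb'(2) \<open>t0 \<le> T\<close> by (simp add: Ch_def)
  have fd: "(\<lambda>\<tau>. force x v \<tau> - force y w \<tau>) \<in> Linf {t0..T}"
    by (intro Linf_diff force_Linf xc yc v w)
  have history_bound: "AE t in lebesgue_on {t0..T}.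
      norm (history t0 (force x v) t - history t0 (force y w) t) \<le> Ch * E t"
    using history_diff[OF force_Linf[OF xc v] force_Linf[OF yc w]] H.K_bound[OF fd] AE_space
  proof eventually_elim
    case (elim t)
    then have t: "t0 \<le> t" "t \<le> T" by simp_all
    have const: "integrable (lebesgue_on {t0..t}) (\<lambda>\<tau>. La' * E t)"
      by (intro continuous_imp_integrable_real continuous_intros)
    have "(LINT \<tau>|lebesgue_on {t0..t}. norm (force x v \<tau> - force y w \<tau>))
        \<le> (LINT \<tau>|lebesgue_on {t0..t}. La' * E t + Cb' * e \<tau>)"
    proof (rule Bochner_Integration.integral_mono_AE)
      show "integrable (lebesgue_on {t0..t}) (\<lambda>\<tau>. norm (force x v \<tau> - force y w \<tau>))"
        using t by (intro integrable_norm Linf_integrable[OF fd]) auto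
      show "integrable (lebesgue_on {t0..t}) (\<lambda>\<tau>. La' * E t + Cb' * e \<tau>)"
        by (intro Bochner_Integration.integrable_add const integrable_mult_right e_int t)
      show "AE \<tau> in lebesgue_on {t0..t}. norm (force x v \<tau> - force y w \<tau>) \<le> La' * E t + Cb' * e \<tau>"
        using AE_interval_subset[OF force_diff order_refl t(2)] AE_space
      proof eventually_elim
        case (elim \<tau>)
        then have "t0 \<le> \<tau>" "\<tau> \<le> t" by simp_all
        with t have "norm (x \<tau> - y \<tau>) \<le> E t"
          using dist[of \<tau>] E_mono[of \<tau> t] by simp
        then have "La' * norm (x \<tau> - y \<tau>) \<le> La' * E t"
          using La'(1) by (rule mult_left_mono)
        with elim(1) show ?case by linarith
      qed
    qed
    also have "\<dots> = La' * E t * (t - t0) + Cb' * E t"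
      using Bochner_Integration.integral_add[OF const integrable_mult_right[OF e_int[OF t(2)]], of Cb']
        LINT_interval_power[OF t(1), of 0] 
        integral_mult_right_zero[of "lebesgue_on {t0..t}" "La' * E t" "\<lambda>\<tau>. (\<tau> - t0) ^ 0"]
      by (simp add: E_def)
    also have "\<dots> \<le> La' * E t * (T - t0) + Cb' * E t"
      using t La'(1) E_nonneg by (intro add_right_mono mult_left_mono) auto
    finally have "C\<Phi> * (LINT \<tau>|lebesgue_on {t0..t}. norm (force x v \<tau> - force y w \<tau>))
        \<le> C\<Phi> * (La' * E t * (T - t0) + Cb' * E t)"
      using H.M_nonneg by (rule mult_left_mono)
    also have "\<dots> = Ch * E t"
      by (simp add: Ch_def algebra_simps)
    finally show ?case using elim(1,2) by simp
  qed
  define Cw where "Cw = Cg * (Ld * Ca + Cd * (La + Ch))"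
  have Cw: "Cw \<ge> 0"
    using Cg(2) Ld(1) Ca(2) Cd(2) La(1) Ch by (simp add: Cw_def)
  have control_bound: "AE t in lebesgue_on {t0..T}. norm (v t - w t) \<le> Cw * E t"
    using equivalent_control[OF x(1) start_le x(2)] equivalent_control[OF y(1) start_le y(2)]
      La(2) Ld(2) Ca(1) Cd(1) Cg(1) history_bound AE_space
  proof eventually_elim
    case (elim t)
    then have t: "t \<in> {t0..T}" by simp
    note xy = dist[OF t]
    let ?p = "a t (x t) + history t0 (force x v) t" and ?q = "a t (y t) + history t0 (force y w) t"
    have "G_inv t (x t) = G_inv t (y t)"
      using G_const[of "x t" "y t" t] x(2) y(2) t by simp
    then have "w t - v t = G_inv t (y t) *v (D (x t) *v ?p) - G_inv t (y t) *v (D (y t) *v ?q)"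
      using elim(1,2) by simp
    also have "\<dots> = G_inv t (y t) *v ((D (x t) - D (y t)) *v ?p + D (y t) *v (?p - ?q))"
      by (simp only: matrix_vector_mult_diff_distrib matrix_vector_mult_diff_rdistrib
          matrix_vector_right_distrib) simp
    also have "norm \<dots> \<le> Cg * ((Ld * E t) * Ca + Cd * (La * E t + Ch * E t))"
    proof (intro norm_matrix_vector_mult_bound norm_triangle_mono elim)
      show "norm (D (x t) - D (y t)) \<le> Ld * E t"
        using elim(4) mult_left_mono[OF xy Ld(1)] by linarith
      have "?p - ?q = (a t (x t) - a t (y t)) + (history t0 (force x v) t - history t0 (force y w) t)"
        by simp
      also have "norm \<dots> \<le> La * E t + Ch * E t"
        using elim(3) mult_left_mono[OF xy La(1)] by (intro norm_triangle_mono elim(8)) linarith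
      finally show "norm (?p - ?q) \<le> La * E t + Ch * E t" .
    qed
    also have "\<dots> = Cw * E t" by (simp add: Cw_def algebra_simps)
    finally show ?case by (simp add: norm_minus_commute)
  qed
  define Cr where "Cr = La + (Lb * Cv + Cb * Cw) + Ch"
  have velocity_bound: "AE t in lebesgue_on {t0..T}. norm (dv t) \<le> Cr * E t"
    using La(2) Lb(2) Cv(1) Cb(1) control_bound history_bound AE_space
  proof eventually_elim
    case (elim t)
    then have t: "t \<in> {t0..T}" by simp
    note xy = dist[OF t]
    have "dv t = (a t (x t) - a t (y t)) + ((b t (x t) - b t (y t)) *v v t + b t (y t) *v (v t - w t)) +
        (history t0 (force x v) t - history t0 (force y w) t)"
      by (simp add: dv_def velocity_def matrix_vector_mult_diff_distrib matrix_vector_mult_diff_rdistrib)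
    also have "norm \<dots> \<le> La * E t + ((Lb * E t) * Cv + Cb * (Cw * E t)) + Ch * E t"
    proof (intro norm_matrix_vector_mult_bound norm_triangle_mono elim)
      show "norm (a t (x t) - a t (y t)) \<le> La * E t"
        using elim(1) mult_left_mono[OF xy La(1)] by linarith
      show "norm (b t (x t) - b t (y t)) \<le> Lb * E t"
        using elim(2) mult_left_mono[OF xy Lb(1)] by linarith
    qed
    also have "\<dots> = Cr * E t" by (simp add: Cr_def algebra_simps)
    finally show ?case .
  qed
  have "AE t in lebesgue_on {t0..T}. e t \<le> (Cw + Cr) * (LINT \<tau>|lebesgue_on {t0..t}. e \<tau>)"
    unfolding E_def[symmetric] using control_bound velocity_bound
    by eventually_elim (simp add: e_def distrib_right)
  moreover have "0 \<le> Cw + Cr"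
    using Cw La(1) Lb(1) Cv(2) Cb(2) Ch by (simp add: Cr_def)
  ultimately have "AE t in lebesgue_on {t0..T}. e t = 0"
    using integral_inequality_imp_AE_zero[OF e_meas e_nonneg _ e_bound] by blast
  then have "E T = 0"
    unfolding E_def by (rule integral_eq_zero_AE)
  with dist[of T] \<open>t0 \<le> T\<close> show ?thesis by simp
qed

end

theorem corollary3:
  fixes \<Phi> :: "real \<Rightarrow> real \<Rightarrow> real^'n^'n"
    and a a' :: "real \<Rightarrow> real^'n \<Rightarrow> real^'n"
    and b b' :: "real \<Rightarrow> real^'n \<Rightarrow> real^'m^'n"
    and u :: "real \<Rightarrow> real^'n \<Rightarrow> real^'m"
    and s :: "real^'n \<Rightarrow> real^'m"
    and t0 :: real and x0 :: "real^'n"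
  assumes "(\<lambda>(t, \<tau>). \<Phi> t \<tau>) \<in> borel_measurable (lebesgue_on {(t, \<tau>). t \<ge> \<tau>})"
    and "locally_ess_bounded_on {(t, \<tau>). t \<ge> \<tau>} (\<lambda>(t, \<tau>). \<Phi> t \<tau>)"
    and "measurable_tx a" "locally_ess_bounded_tx a" "\<forall>t. continuous_on UNIV (a t)"
    and "measurable_tx a'" "locally_ess_bounded_tx a'" "\<forall>t. continuous_on UNIV (a' t)"
    and "measurable_tx b" "locally_ess_bounded_tx b" "\<forall>t. continuous_on UNIV (b t)"
    and "measurable_tx b'" "locally_ess_bounded_tx b'" "\<forall>t. continuous_on UNIV (b' t)"
    and "measurable_tx u" "locally_ess_bounded_tx u"
    and "C1_map s"
    and "piecewise_Lipschitz_tx u {x. s x = 0}"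
    and "AE t in lebesgue. \<forall>x. invertible (G_matrix s b t x)"
    and "locally_ess_bounded_tx (\<lambda>t x. matrix_inv (G_matrix s b t x))"
  shows
    "(\<forall>t1 ts x ueq.
        t0 \<le> ts \<and> ts \<le> t1 \<and>
        Utkin_solution_with a b \<Phi> a' b' u t0 x0 {t0..t1} x ueq \<and>
        (\<forall>t \<in> {t0..<ts}. s (x t) \<noteq> 0) \<and> (\<forall>t \<in> {ts..t1}. s (x t) = 0) \<longrightarrow>
        (let K = sliding_operator s b \<Phi> b' x ts; g = sliding_g s a b \<Phi> a' b' u x t0 ts in
           bounded_linear_Linf {ts<..<t1} K \<and>
           g \<in> Linf {ts<..<t1} \<and>
           (\<lambda>k. Linf_norm {ts<..<t1} (\<lambda>t. ueq t - (\<Sum>i<k. (K ^^ i) g t))) \<longlonglongrightarrow> 0 \<and>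
           (AE t in lebesgue_on {t0..t1}.
              ueq t = (if t < ts then u t (x t) else (\<Sum>i. (K ^^ i) g t))))) \<and>
     (locally_Lipschitz_tx a \<and> locally_Lipschitz_tx b \<and>
      locally_Lipschitz_tx a' \<and> locally_Lipschitz_tx b' \<and>
      locally_Lipschitz_tx (\<lambda>t x. jacobian s (at x)) \<and>
      (\<forall>t y1 y2. s y1 = 0 \<and> s y2 = 0 \<longrightarrow>
         G_matrix s b t y1 = G_matrix s b t y2 \<and> b' t y1 = b' t y2) \<longrightarrow>
      (\<forall>I x y.
         Utkin_solution a b \<Phi> a' b' u t0 x0 I x \<and> (\<forall>t \<in> I. s (x t) = 0) \<and>
         Utkin_solution a b \<Phi> a' b' u t0 x0 I y \<and> (\<forall>t \<in> I. s (y t) = 0) \<longrightarrow>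
         (\<forall>t \<in> I. x t = y t)))"
proof -
  interpret controlled_system \<Phi> a a' b b' u s
    by unfold_locales (fact assms)+
  show ?thesis
  proof (rule conjI; intro allI impI)
    fix t1 ts x ueq
    assume *: "t0 \<le> ts \<and> ts \<le> t1 \<and>
        Utkin_solution_with a b \<Phi> a' b' u t0 x0 {t0..t1} x ueq \<and>
        (\<forall>t \<in> {t0..<ts}. s (x t) \<noteq> 0) \<and> (\<forall>t \<in> {ts..t1}. s (x t) = 0)"
    then have "solves t0 t1 x ueq"
      by (intro Utkin_solution_solves[of t0 x0 "{t0..t1}"]) auto
    then show "let K = sliding_operator s b \<Phi> b' x ts; g = sliding_g s a b \<Phi> a' b' u x t0 ts in
           bounded_linear_Linf {ts<..<t1} K \<and>
           g \<in> Linf {ts<..<t1} \<and>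
           (\<lambda>k. Linf_norm {ts<..<t1} (\<lambda>t. ueq t - (\<Sum>i<k. (K ^^ i) g t))) \<longlonglongrightarrow> 0 \<and>
           (AE t in lebesgue_on {t0..t1}.
              ueq t = (if t < ts then u t (x t) else (\<Sum>i. (K ^^ i) g t)))"
      using * unfolding Let_def by (intro conjI equivalent_control_Neumann) blast+
  next
    fix I x y
    assume hyp: "locally_Lipschitz_tx a \<and> locally_Lipschitz_tx b \<and>
      locally_Lipschitz_tx a' \<and> locally_Lipschitz_tx b' \<and>
      locally_Lipschitz_tx (\<lambda>t x. jacobian s (at x)) \<and>
      (\<forall>t y1 y2. s y1 = 0 \<and> s y2 = 0 \<longrightarrow>
         G_matrix s b t y1 = G_matrix s b t y2 \<and> b' t y1 = b' t y2)"
      and sol: "Utkin_solution a b \<Phi> a' b' u t0 x0 I x \<and> (\<forall>t \<in> I. s (x t) = 0) \<and>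
         Utkin_solution a b \<Phi> a' b' u t0 x0 I y \<and> (\<forall>t \<in> I. s (y t) = 0)"
    show "\<forall>t \<in> I. x t = y t"
    proof
      fix T assume T: "T \<in> I"
      obtain v w where v: "Utkin_solution_with a b \<Phi> a' b' u t0 x0 I x v"
        and w: "Utkin_solution_with a b \<Phi> a' b' u t0 x0 I y w"
        using sol unfolding Utkin_solution_def by blast
      have I: "is_interval I" "t0 \<in> I" "\<forall>t\<in>I. t0 \<le> t"
        using v unfolding Utkin_solution_with_def Utkin_first_kind_def Utkin_second_kind_def
          solution_with_control_def interval_from_def by blast+
      have sub: "{t0..T} \<subseteq> I" and "t0 \<le> T"
        using I T mem_is_interval_1_I[OF I(1,2) T] by auto
      show "x T = y T"
      proof (rule solves_unique_on_manifold)
        show "solves t0 T x v" "solves t0 T y w"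
          using Utkin_solution_solves(1)[OF v sub \<open>t0 \<le> T\<close>] Utkin_solution_solves(1)[OF w sub \<open>t0 \<le> T\<close>] .
        show "x t0 = y t0"
          using Utkin_solution_solves(2)[OF v sub \<open>t0 \<le> T\<close>] Utkin_solution_solves(2)[OF w sub \<open>t0 \<le> T\<close>] by simp
        show "\<forall>t\<in>{t0..T}. s (x t) = 0" "\<forall>t\<in>{t0..T}. s (y t) = 0"
          using sol sub by blast+
      qed (use hyp in blast)+
    qed
  qed
qed

end
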